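(* Let $\lambda>0$ and $0<\sigma<1$. Then for every $u\in H^\sigma_\lambda$, \[ Q_{\sigma,\lambda}\int_{-1}^{1}\frac{u^2(x)}{(1-x^2)^{\sigma/2}}\,d\mu_\lambda(x)\le \int_{-1}^{1}u(x)\,A_\sigma^\lambda u(x)\,d\mu_\lambda(x), \qquad\text{where}\quad Q_{\sigma,\lambda}=2^\sigma\frac{\Gamma\!\left(\frac{\lambda}{2}+\frac{1+\sigma}{4}\right)^2}{\Gamma\!\left(\frac{\lambda}{2}+\frac{1-\sigma}{4}\right)^2}. \]
   Context: For $\lambda>-1/2$ let $d\mu_\lambda(x)=(1-x^2)^{\lambda-1/2}\,dx$ on $(-1,1)$ and $L^2_\lambda=L^2((-1,1),d\mu_\lambda)$. Let $C_n^\lambda$ be the ultraspherical (Gegenbauer) polynomial of degree $n$ and order $\lambda$, and $c_n^\lambda=C_n^\lambda/\|C_n^\lambda\|_{L^2_\lambda}$, so $\{c_n^\lambda\}_{n\ge0}$ is an orthonormal basis of $L^2_\lambda$. For $f\in L^2_\lambda$ put $a_n^\lambda(f)=\int_{-1}^1 f(y)c_n^\lambda(y)\,d\mu_\lambda(y)$. For $\sigma>0$ the operator $A_\sigma^\lambda$ is defined spectrally by $A_\sigma^\lambda f=\sum_{n\ge0}\frac{\Gamma(n+\lambda+\frac{1+\sigma}{2})}{\Gamma(n+\lambda+\frac{1-\sigma}{2})}a_n^\lambda(f)c_n^\lambda$ (equivalently $A_\sigma^\lambda=\Gamma(\sqrt{-\mathcal L_\lambda}+\frac{1+\sigma}2)/\Gamma(\sqrt{-\mathcal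 L_\lambda}+\frac{1-\sigma}2)$ with $\mathcal L_\lambda=(1-x^2)\frac{d^2}{dx^2}-(2\lambda+1)x\frac{d}{dx}-\lambda^2$, which has $c_n^\lambda$ as eigenfunctions with eigenvalue $-(n+\lambda)^2$). The Sobolev space is $H^\sigma_\lambda=\{f\in L^2_\lambda:\sum_{n\ge0}(n+\lambda)^\sigma (a_n^\lambda(f))^2<\infty\}$. For $u\in H^\sigma_\lambda$, $\int_{-1}^1 u\,A_\sigma^\lambda u\,d\mu_\lambda$ means $\sum_{n\ge0}\frac{\Gamma(n+\lambda+\frac{1+\sigma}{2})}{\Gamma(n+\lambda+\frac{1-\sigma}{2})}(a_n^\lambda(u))^2$. *)

theory Defs
  imports "HOL-Analysis.Analysis"
begin

definition ultra_weight :: "real \<Rightarrow> real \<Rightarrow> real" where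
  "ultra_weight lam x = (1 - x\<^sup>2) powr (lam - 1/2)"

definition gegenbauer :: "real \<Rightarrow> nat \<Rightarrow> real \<Rightarrow> real" where
  "gegenbauer lam n x =
     (\<Sum>k\<le>n div 2. (-1)^k * Gamma (real (n - k) + lam)
        / (Gamma lam * fact k * fact (n - 2*k)) * (2*x)^(n - 2*k))"

definition gegenbauer_norm :: "real \<Rightarrow> nat \<Rightarrow> real" where
  "gegenbauer_norm lam n =
     sqrt (LINT x:{-1<..<1}|lborel. (gegenbauer lam n x)\<^sup>2 * ultra_weight lam x)"

definition gegenbauer_normalized :: "real \<Rightarrow> nat \<Rightarrow> real \<Rightarrow> real" where
  "gegenbauer_normalized lam n x = gegenbauer lam n x / gegenbauer_norm lam n"

definition gegenbauer_coeff :: "real \<Rightarrow> (real \<Rightarrow> real) \<Rightarrow> nat \<Rightarrow> real" where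
  "gegenbauer_coeff lam f n =
     (LINT y:{-1<..<1}|lborel. f y * gegenbauer_normalized lam n y * ultra_weight lam y)"

definition in_L2_lam :: "real \<Rightarrow> (real \<Rightarrow> real) \<Rightarrow> bool" where
  "in_L2_lam lam f \<longleftrightarrow> f \<in> borel_measurable lborel \<and>
     set_integrable lborel {-1<..<1} (\<lambda>x. (f x)\<^sup>2 * ultra_weight lam x)"

definition in_Sobolev_lam :: "real \<Rightarrow> real \<Rightarrow> (real \<Rightarrow> real) \<Rightarrow> bool" where
  "in_Sobolev_lam sg lam f \<longleftrightarrow> in_L2_lam lam f \<and>
     summable (\<lambda>n. (real n + lam) powr sg * (gegenbauer_coeff lam f n)\<^sup>2)"

text \<open>Multiplier of A_sigma^lam on c_n^lam.\<close>
definition A_mult :: "real \<Rightarrow> real \<Rightarrow> nat \<Rightarrow> real" where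
  "A_mult sg lam n = Gamma (real n + lam + (1 + sg)/2) / Gamma (real n + lam + (1 - sg)/2)"

text \<open>Quadratic form int u A_sigma^lam u d mu_lam.\<close>
definition A_form :: "real \<Rightarrow> real \<Rightarrow> (real \<Rightarrow> real) \<Rightarrow> real" where
  "A_form sg lam u = (\<Sum>n. A_mult sg lam n * (gegenbauer_coeff lam u n)\<^sup>2)"

end

(* Expand u in the Gegenbauer polynomials C_n. By the three-term recurrence, multiplication by x has
   nonnegative coefficients in this basis (lam > 0); since (1 - x^2)^(-sg/2) is a power series in x^2
   with nonnegative coefficients, the matrix W of multiplication by (1 - x^2)^(-sg/2) has nonnegative
   entries. The inequality Q W <= diag(A_mult) then follows from the Schur test for matrices once a
   positive vector p with Q W p <= A_mult p is found. Take for p the coefficients of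
   (1 + x)(1 - x^2)^(-(2 lam + 1 - sg)/4): both p and W p are given by explicit Gamma quotients, and
   the duplication formula gives equality for even n, while for odd n the inequality reduces to the
   monotonicity of z / (z + 1/2). Completeness of the C_n in L^2 and Fatou's lemma pass from
   polynomials to general u. *)
theory Submission
  imports Defs
begin

text \<open>The obstacle is that W p is an infinite sum. It is never formed: replacing the weight by
  a partial sum of its power series turns C_n times the weight into a finite nonnegative combination
  of Gegenbauer polynomials, truncating such a combination can only lower its pairing with p, and
  just the integrals are passed to the limit. This yields W p from above on every finite index set,
  which is all that the Schur test needs. Choice of p: put l = (2 lam - 1 + sg)/4. The ground
  function times the weight of order lam is (1 + x) times the weight of order l, and multiplying by
  (1 - x^2)^(-sg/2) lowers l by sg/2. So p and W p, up to the norms of the C_n, are two members of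
  one family of moments, which is therefore computed for an arbitrary order l. Without the factor 1
  + x all odd coefficients would vanish, whereas the Schur test divides by every entry of p. By
  parity the even moments see only the summand 1 and the odd ones only x.\<close>

section \<open>Inequalities and identities for the Gamma function\<close>

lemma Gamma_duplication_real:
  fixes z :: real
  assumes "z > 0"
  shows "Gamma z * Gamma (z + 1/2) = 2 powr (1 - 2*z) * sqrt pi * Gamma (2*z)"
proof -
  have nn: "complex_of_real z \<notin> \<int>\<^sub>\<le>\<^sub>0" "complex_of_real z + 1/2 \<notin> \<int>\<^sub>\<le>\<^sub>0"
  proof -
    show "complex_of_real z \<notin> \<int>\<^sub>\<le>\<^sub>0" using assms by (auto elim!: nonpos_Ints_cases simp: complex_eq_iff)
    show "complex_of_real z + 1/2 \<notin> \<int>\<^sub>\<le>\<^sub>0"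
    proof
      assume "complex_of_real z + 1/2 \<in> \<int>\<^sub>\<le>\<^sub>0"
      then obtain n where "complex_of_real z + 1/2 = of_int n" "n \<le> 0" by (auto elim!: nonpos_Ints_cases)
      then have "Re (complex_of_real z + 1/2) = of_int n" by simp
      with \<open>n \<le> 0\<close> assms show False by simp
    qed
  qed
  have "complex_of_real (Gamma z * Gamma (z + 1/2))
      = complex_of_real (exp ((1 - 2*z) * ln 2) * sqrt pi * Gamma (2*z))"
    using Gamma_legendre_duplication[OF nn]
    by (simp add: Gamma_complex_of_real[symmetric] exp_of_real[symmetric])
  then have "Gamma z * Gamma (z + 1/2) = exp ((1 - 2*z) * ln 2) * sqrt pi * Gamma (2*z)"
    by (simp only: of_real_eq_iff)
  then show ?thesis by (simp add: powr_def)
qed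

lemma Gamma_plus1_pos: "z > 0 \<Longrightarrow> Gamma (z + 1) = z * Gamma (z::real)"
  by (rule Gamma_plus1) (auto elim!: nonpos_Ints_cases)

text \<open>Log-convexity at z + s = (1 - s) z + s (z + 1), together with Gamma (z + 1) = z Gamma z.
  It serves to bound the multiplier \<open>A_mult\<close> by a power of n + lam.\<close>

lemma Gamma_add_le_powr:
  fixes z s :: real
  assumes "z > 0" "0 \<le> s" "s \<le> 1"
  shows "Gamma (z + s) \<le> Gamma z * z powr s"
proof -
  have "(ln \<circ> Gamma) ((1 - s) *\<^sub>R z + s *\<^sub>R (z + 1)) \<le> (1 - s) * (ln \<circ> Gamma) z + s * (ln \<circ> Gamma) (z + 1)"
    using assms by (intro convex_onD[OF log_convex_Gamma_real]) auto
  moreover have "(1 - s) *\<^sub>R z + s *\<^sub>R (z + 1) = z + s" by (simp add: algebra_simps)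
  moreover have "ln (Gamma (z + 1)) = ln z + ln (Gamma z)"
    using assms less_imp_neq[OF Gamma_real_pos[OF assms(1)]] by (simp add: Gamma_plus1_pos ln_mult)
  ultimately have "ln (Gamma (z + s)) \<le> ln (Gamma z) + s * ln z"
    by (simp add: algebra_simps)
  also have "\<dots> = ln (Gamma z * z powr s)"
    using assms less_imp_neq[OF Gamma_real_pos[OF assms(1)]] by (simp add: ln_mult ln_powr)
  finally show ?thesis
    using assms by (subst (asm) ln_le_cancel_iff) (auto intro!: Gamma_real_pos mult_pos_pos)
qed

text \<open>Both arguments in \<open>A_mult\<close> are doubled: with 2 x - 2 y = sg the multiplier
  splits into the half-step Gamma values that also occur in the moments, and the powers of two leave
  exactly the factor 2^sg of the Hardy constant.\<close>

lemma Gamma_double_ratio: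
  fixes x y :: real
  assumes "x > 0" "y > 0"
  shows "Gamma (2*x) / Gamma (2*y)
       = 2 powr (2*x - 2*y) * (Gamma x * Gamma (x + 1/2)) / (Gamma y * Gamma (y + 1/2))"
proof -
  have "Gamma (2*y) \<noteq> 0" using less_imp_neq[OF Gamma_real_pos[of "2*y"]] assms by simp
  moreover have "2 powr (2*x - 2*y) * 2 powr (1 - 2*x) = (2 powr (1 - 2*y) :: real)"
    by (simp add: powr_add[symmetric])
  ultimately show ?thesis
    unfolding Gamma_duplication_real[OF assms(1)] Gamma_duplication_real[OF assms(2)]
    by (simp add: mult.assoc[symmetric])
qed

section \<open>Recurrence and parity of the Gegenbauer polynomials\<close>

text \<open>Extended by zero beyond n div 2, so that the three polynomials of the recurrence can be
  summed over one common range.\<close>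

definition gegenbauer_term :: "real \<Rightarrow> nat \<Rightarrow> real \<Rightarrow> nat \<Rightarrow> real" where
  "gegenbauer_term lam n x k = (if 2 * k \<le> n then (-1)^k * Gamma (real (n - k) + lam)
        / (Gamma lam * fact k * fact (n - 2*k)) * (2*x)^(n - 2*k) else 0)"

lemma gegenbauer_eq_sum_terms:
  assumes "n \<le> N"
  shows "gegenbauer lam n x = (\<Sum>k\<le>N. gegenbauer_term lam n x k)"
proof -
  have "(\<Sum>k\<le>N. gegenbauer_term lam n x k) = (\<Sum>k\<le>n div 2. gegenbauer_term lam n x k)"
    using assms by (intro sum.mono_neutral_right) (auto simp: gegenbauer_term_def)
  also have "\<dots> = gegenbauer lam n x"
    unfolding gegenbauer_def by (intro sum.cong) (auto simp: gegenbauer_term_def)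
  finally show ?thesis by simp
qed

lemma gegenbauer_term_rec_0:
  assumes "lam > 0"
  shows "real (n + 2) * gegenbauer_term lam (n + 2) x 0
       = 2 * (real n + 1 + lam) * x * gegenbauer_term lam (n + 1) x 0"
proof -
  have "Gamma (real n + 2 + lam) = (real n + 1 + lam) * Gamma (real n + 1 + lam)"
    using Gamma_plus1_pos[of "real n + 1 + lam"] assms by (simp add: add_ac)
  moreover have "Gamma lam > 0" using assms by (simp add: Gamma_real_pos)
  ultimately show ?thesis
    by (simp add: gegenbauer_term_def add_ac divide_simps)
qed

text \<open>The recurrence already holds power by power: all three terms carry x^(n - 2k), whence
  the shift between \<open>Suc k\<close> and \<open>k\<close>.\<close>

lemma gegenbauer_term_rec_Suc:
  assumes "lam > 0"
  shows "real (n + 2) * gegenbauer_term lam (n + 2) x (Suc k)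
       = 2 * (real n + 1 + lam) * x * gegenbauer_term lam (n + 1) x (Suc k)
         - (real n + 2 * lam) * gegenbauer_term lam n x k"
proof -
  have G0: "Gamma lam > 0" using assms by (simp add: Gamma_real_pos)
  consider "2 * k > n" | "2 * k = n" | "2 * k < n" by linarith
  then show ?thesis
  proof cases
    case 1
    then show ?thesis by (simp add: gegenbauer_term_def)
  next
    \<comment> \<open>The constant term: here the summand from degree n + 1 is cut off to zero, and
      the other two balance.\<close>
    case 2
    have "Gamma (real (Suc k) + lam) = (real k + lam) * Gamma (real k + lam)"
      using Gamma_plus1_pos[of "real k + lam"] assms by (simp add: add_ac)
    then show ?thesis using G0 unfolding 2[symmetric]
      by (simp add: gegenbauer_term_def divide_simps) (simp add: algebra_simps)
  next
    case 3
    then obtain j where j: "n = 2 * k + Suc j" using less_iff_Suc_add[of "2*k" n] by auto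
    have e: "n + 2 - Suc k = Suc (n - k)" "n + 1 - Suc k = n - k"
        "n + 2 - 2 * Suc k = Suc j" "n + 1 - 2 * Suc k = j" "n - 2 * k = Suc j" "2 * Suc k \<le> n + 2"
        "2 * Suc k \<le> n + 1" "2 * k \<le> n"
      using j by auto
    define r where "r = real (n - k)"
    have r: "r = real k + real j + 1" using j by (simp add: r_def)
    have n: "real n = 2 * real k + real j + 1" using j by simp
    have G: "Gamma (real (Suc (n - k)) + lam) = (r + lam) * Gamma (r + lam)"
      using Gamma_plus1_pos[of "r + lam"] assms by (simp add: r_def add_ac)
    define c where "c = (-1)^k * Gamma (r + lam) * (2*x)^j / (Gamma lam * fact k * fact j)"
    have t2: "gegenbauer_term lam (n + 2) x (Suc k) = - c * (r + lam) * (2*x) / ((real k + 1) * (real j + 1))"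
      unfolding gegenbauer_term_def e G c_def by (simp add: e add_ac) (simp add: mult_ac)
    have t1: "gegenbauer_term lam (n + 1) x (Suc k) = - c / (real k + 1)"
      unfolding gegenbauer_term_def e c_def r_def using 3 by (simp add: add_ac)
    have t0: "gegenbauer_term lam n x k = c * (2*x) / (real j + 1)"
      unfolding gegenbauer_term_def e c_def r_def using 3 by (simp add: add_ac) (simp add: mult_ac)
    show ?thesis unfolding t2 t1 t0 r of_nat_add n
      by (simp add: divide_simps) (simp add: algebra_simps)
  qed
qed

lemma gegenbauer_rec:
  assumes "lam > 0"
  shows "real (n + 2) * gegenbauer lam (n + 2) x
       = 2 * (real n + 1 + lam) * x * gegenbauer lam (n + 1) x - (real n + 2 * lam) * gegenbauer lam n x"
proof -
  have "real (n + 2) * gegenbauer lam (n + 2) x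
      = real (n + 2) * gegenbauer_term lam (n + 2) x 0
        + (\<Sum>k\<le>n+1. real (n + 2) * gegenbauer_term lam (n + 2) x (Suc k))"
    using gegenbauer_eq_sum_terms[of "n+2" "Suc (n+1)" lam x]
    by (simp only: sum.atMost_Suc_shift[of _ "n+1"] distrib_left sum_distrib_left)
  also have "\<dots> = 2 * (real n + 1 + lam) * x * (gegenbauer_term lam (n + 1) x 0
        + (\<Sum>k\<le>n+1. gegenbauer_term lam (n + 1) x (Suc k)))
      - (real n + 2 * lam) * (\<Sum>k\<le>n+1. gegenbauer_term lam n x k)"
    unfolding gegenbauer_term_rec_0[OF assms] gegenbauer_term_rec_Suc[OF assms] sum_subtractf
      distrib_left sum_distrib_left by simp
  also have "gegenbauer_term lam (n + 1) x 0 + (\<Sum>k\<le>n+1. gegenbauer_term lam (n + 1) x (Suc k))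
      = gegenbauer lam (n + 1) x"
    using gegenbauer_eq_sum_terms[of "n+1" "Suc (n+1)" lam x]
    by (simp only: sum.atMost_Suc_shift[of _ "n+1"])
  also have "(\<Sum>k\<le>n+1. gegenbauer_term lam n x k) = gegenbauer lam n x"
    by (rule gegenbauer_eq_sum_terms[symmetric]) simp
  finally show ?thesis .
qed

lemma gegenbauer_0 [simp]: "lam > 0 \<Longrightarrow> gegenbauer lam 0 x = 1"
  using less_imp_neq[OF Gamma_real_pos[of lam]] by (simp add: gegenbauer_def)

lemma gegenbauer_1: "lam > 0 \<Longrightarrow> gegenbauer lam (Suc 0) x = 2 * lam * x"
  using less_imp_neq[OF Gamma_real_pos[of lam]] Gamma_plus1_pos[of lam]
  by (simp add: gegenbauer_def add.commute)

lemma gegenbauer_mult_x_0: "lam > 0 \<Longrightarrow> x * gegenbauer lam 0 x = 1 / (2 * lam) * gegenbauer lam (Suc 0) x"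
  by (simp add: gegenbauer_1)

lemma gegenbauer_mult_x_Suc:
  assumes "lam > 0"
  shows "x * gegenbauer lam (Suc n) x
       = (real n + 2) / (2 * (real n + 1 + lam)) * gegenbauer lam (Suc (Suc n)) x
         + (real n + 2 * lam) / (2 * (real n + 1 + lam)) * gegenbauer lam n x"
proof -
  have "2 * (real n + 1 + lam) \<noteq> 0" using assms by simp
  moreover have "(2 * (real n + 1 + lam)) * (x * gegenbauer lam (Suc n) x)
     = (real n + 2) * gegenbauer lam (Suc (Suc n)) x + (real n + 2 * lam) * gegenbauer lam n x"
    using gegenbauer_rec[OF assms, of n x] by (simp add: algebra_simps)
  ultimately show ?thesis
    by (metis (no_types, lifting) add_divide_distrib nonzero_mult_div_cancel_left times_divide_eq_left)
qed

lemma gegenbauer_minus: "gegenbauer lam n (- x) = (-1) ^ n * gegenbauer lam n x"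
proof -
  have "(2 * - x) ^ (n - 2 * k) = (-1) ^ n * (2 * x) ^ (n - 2 * k)" if "k \<le> n div 2" for k
  proof -
    have "even (n - 2 * k) = even n" using that by auto
    then have "(-1::real) ^ n = (-1) ^ (n - 2 * k)" by (simp add: uminus_power_if)
    then show ?thesis by (simp add: power_minus[of "2 * x"])
  qed
  then show ?thesis unfolding gegenbauer_def sum_distrib_left
    by (intro sum.cong) (auto simp: mult_ac)
qed

lemma continuous_on_gegenbauer [continuous_intros]:
  "continuous_on S f \<Longrightarrow> continuous_on S (\<lambda>x. gegenbauer lam n (f x))"
  unfolding gegenbauer_def by (intro continuous_intros)

lemma measurable_gegenbauer [measurable]: "gegenbauer lam n \<in> borel_measurable borel"
  by (intro borel_measurable_continuous_onI continuous_intros)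

section \<open>Ultraspherical measures\<close>

text \<open>With the weight and the interval inside the measure, multiplying by a power of 1 - x^2
  becomes a change of the order l.\<close>

definition ultra_measure :: "real \<Rightarrow> real measure" where
  "ultra_measure l = density lborel (\<lambda>x. ennreal (indicator {-1<..<1} x * ultra_weight l x))"

lemma sets_ultra_measure [measurable_cong, simp]: "sets (ultra_measure l) = sets borel"
  by (simp add: ultra_measure_def)

lemma space_ultra_measure [simp]: "space (ultra_measure l) = UNIV"
  by (simp add: ultra_measure_def)

lemma measurable_ultra_weight [measurable]: "ultra_weight l \<in> borel_measurable borel"
  unfolding ultra_weight_def[abs_def] by measurable

lemma ultra_weight_nonneg [simp]: "ultra_weight l x \<ge> 0"
  by (simp add: ultra_weight_def)

lemma integral_ultra_measure:
  fixes f :: "real \<Rightarrow> real"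
  assumes [measurable]: "f \<in> borel_measurable borel"
  shows "integral\<^sup>L (ultra_measure l) f = (LINT x:{-1<..<1}|lborel. f x * ultra_weight l x)"
  unfolding ultra_measure_def set_lebesgue_integral_def
  by (subst integral_real_density) (auto simp: mult_ac)

lemma integrable_ultra_measure_iff:
  fixes f :: "real \<Rightarrow> real"
  assumes [measurable]: "f \<in> borel_measurable borel"
  shows "integrable (ultra_measure l) f \<longleftrightarrow> set_integrable lborel {-1<..<1} (\<lambda>x. f x * ultra_weight l x)"
  unfolding ultra_measure_def set_integrable_def
  by (subst integrable_real_density) (auto simp: mult_ac)

lemma AE_ultra_measure: "AE x in ultra_measure l. x \<in> {-1<..<1}"
  unfolding ultra_measure_def by (subst AE_density) (auto simp: indicator_def)

lemma one_minus_square_pos: "x \<in> {-1<..<1} \<Longrightarrow> 0 < 1 - (x::real)\<^sup>2"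
  using abs_square_less_1[of x] by auto

lemma ultra_weight_add:
  "x \<in> {-1<..<1} \<Longrightarrow> ultra_weight (l + b) x = (1 - x\<^sup>2) powr b * ultra_weight l x"
  by (simp add: ultra_weight_def powr_add[symmetric] algebra_simps)

lemma integral_ultra_measure_shift:
  fixes f :: "real \<Rightarrow> real"
  assumes [measurable]: "f \<in> borel_measurable borel"
  shows "(\<integral>x. f x * (1 - x\<^sup>2) powr b \<partial>ultra_measure l) = integral\<^sup>L (ultra_measure (l + b)) f"
  by (simp add: integral_ultra_measure set_lebesgue_integral_def)
     (auto intro!: Bochner_Integration.integral_cong simp: indicator_def ultra_weight_add mult_ac)

lemma integrable_ultra_measure_shift:
  fixes f :: "real \<Rightarrow> real"
  assumes [measurable]: "f \<in> borel_measurable borel"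
  shows "integrable (ultra_measure l) (\<lambda>x. f x * (1 - x\<^sup>2) powr b) \<longleftrightarrow> integrable (ultra_measure (l + b)) f"
  by (simp add: integrable_ultra_measure_iff set_integrable_def)
     (auto intro!: Bochner_Integration.integrable_cong simp: indicator_def ultra_weight_add mult_ac)

text \<open>The substitution x = 2 t - 1 turns the weight into a multiple of the integrand of Beta
  (s, s) with s = l + 1/2; the duplication formula then removes Gamma (2 s) and all powers of
  two.\<close>

lemma has_bochner_integral_ultra_weight:
  assumes "l > -1/2"
  shows "has_bochner_integral lborel (\<lambda>x. indicator {-1<..<1} x * ultra_weight l x)
     (sqrt pi * Gamma (l + 1/2) / Gamma (l + 1))"
proof -
  define s where "s = l + 1/2"
  define B where "B = (\<lambda>t::real. t powr (s - 1) * (1 - t) powr (s - 1))"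
  let ?f = "\<lambda>x. indicator {-1<..<1} x * ultra_weight l x"
  have s: "s > 0" using assms by (simp add: s_def)
  have si: "set_integrable lborel {0..1} B"
    unfolding B_def using integrable_Beta[OF s s] by simp
  have "(LINT t:{0..1}|lborel. B t) = Beta s s"
    using set_borel_integral_eq_integral(2)[OF si] has_integral_Beta_real[OF s s]
    by (simp add: integral_unique B_def)
  then have "has_bochner_integral lborel (\<lambda>t. indicator {0..1} t * B t) (Beta s s)"
    using si by (simp add: has_bochner_integral_iff set_integrable_def set_lebesgue_integral_def)
  then have "has_bochner_integral lborel (\<lambda>t. 4 powr (s - 1) * (indicator {0..1} t * B t)) (4 powr (s - 1) * Beta s s)"
    by (intro has_bochner_integral_mult_right) auto
  also have "(\<lambda>t. 4 powr (s - 1) * (indicator {0..1} t * B t)) = (\<lambda>t. ?f (-1 + 2 * t))"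
  proof
    fix t :: real
    show "4 powr (s - 1) * (indicator {0..1} t * B t) = ?f (-1 + 2 * t)"
    proof (cases "0 < t \<and> t < 1")
      case True
      have "1 - (-1 + 2 * t)\<^sup>2 = 4 * (t * (1 - t))" by (simp add: power2_eq_square algebra_simps)
      then show ?thesis using True by (simp add: B_def ultra_weight_def powr_mult s_def)
    next
      case False
      \<comment> \<open>At t = 0 and t = 1 the convention \<open>0 powr a = 0\<close> reconciles the
        closed interval of the Beta integral with the open one.\<close>
      then show ?thesis by (auto simp: B_def indicator_def)
    qed
  qed
  finally have "has_bochner_integral lborel ?f (2 * (4 powr (s - 1) * Beta s s))"
    using lborel_has_bochner_integral_real_affine_iff[of 2 ?f "2 * (4 powr (s - 1) * Beta s s)" "-1"]
    by simp
  moreover have "2 * (4 powr (s - 1) * Beta s s) = sqrt pi * Gamma (l + 1/2) / Gamma (l + 1)"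
  proof -
    have p: "(4::real) powr (s - 1) = 2 powr (2 * s - 2)"
      using powr_powr[of 2 2 "s - 1"] by (simp add: algebra_simps)
    have "2 powr (1 - 2 * s) * 2 * 2 powr (2 * s - 2) = (1::real)"
      by (simp add: powr_diff field_simps)
    moreover have "Gamma (2 * s) > 0" "Gamma (s + 1/2) > 0" "Gamma s > 0"
      using s by (auto intro!: Gamma_real_pos)
    moreover note Gamma_duplication_real[OF s]
    moreover have l: "l + 1/2 = s" "l + 1 = s + 1/2" by (auto simp: s_def)
    ultimately have "2 * 2 powr (2 * s - 2) * (Gamma s * Gamma (s + 1/2)) = sqrt pi * Gamma (2 * s)"
      by (simp add: mult_ac)
    then show ?thesis unfolding l Beta_def p
      using \<open>Gamma (2 * s) > 0\<close> \<open>Gamma (s + 1/2) > 0\<close>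
      by (simp add: frac_eq_eq)
  qed
  ultimately show ?thesis by simp
qed

lemma finite_measure_ultra_measure:
  assumes "l > -1/2"
  shows "finite_measure (ultra_measure l)"
proof
  have "emeasure (ultra_measure l) UNIV = (\<integral>\<^sup>+x. ennreal (indicator {-1<..<1} x * ultra_weight l x) \<partial>lborel)"
    unfolding ultra_measure_def by (subst emeasure_density) auto
  also have "\<dots> < \<infinity>"
    using has_bochner_integral_ultra_weight[OF assms]
    by (subst nn_integral_eq_integral) (auto simp: has_bochner_integral_iff)
  finally show "emeasure (ultra_measure l) (space (ultra_measure l)) \<noteq> \<infinity>" by simp
qed

lemma measure_ultra_measure:
  assumes "l > -1/2"
  shows "measure (ultra_measure l) UNIV = sqrt pi * Gamma (l + 1/2) / Gamma (l + 1)"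
proof -
  have "measure (ultra_measure l) UNIV = (\<integral>x. 1 \<partial>ultra_measure l)" by simp
  also have "\<dots> = sqrt pi * Gamma (l + 1/2) / Gamma (l + 1)"
    using has_bochner_integral_ultra_weight[OF assms]
    by (subst integral_ultra_measure) (auto simp: has_bochner_integral_iff set_lebesgue_integral_def)
  finally show ?thesis .
qed

lemma integrable_ultra_measure_continuous:
  fixes f :: "real \<Rightarrow> real"
  assumes "l > -1/2" and f: "continuous_on UNIV f"
  shows "integrable (ultra_measure l) f"
proof -
  interpret finite_measure "ultra_measure l" by (rule finite_measure_ultra_measure[OF assms(1)])
  have "compact (f ` {-1..1})"
    using f by (intro compact_continuous_image) (auto intro: continuous_on_subset)
  then obtain B where B: "\<And>x. x \<in> {-1..1} \<Longrightarrow> norm (f x) \<le> B"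
    using compact_imp_bounded bounded_iff by (metis (no_types, lifting) imageI)
  show ?thesis
  proof (rule integrable_const_bound[where B = B])
    show "AE x in ultra_measure l. norm (f x) \<le> B"
      using AE_ultra_measure by eventually_elim (use B in force)
    show "f \<in> borel_measurable (ultra_measure l)"
      using borel_measurable_continuous_onI[OF f] by simp
  qed
qed

lemma integral_ultra_measure_minus:
  fixes f :: "real \<Rightarrow> real"
  assumes [measurable]: "f \<in> borel_measurable borel"
  shows "(\<integral>x. f (- x) \<partial>ultra_measure l) = integral\<^sup>L (ultra_measure l) f"
  unfolding integral_ultra_measure[OF assms] set_lebesgue_integral_def
  by (subst integral_ultra_measure, simp,
      subst lborel_integral_real_affine[of "-1" "\<lambda>x. indicator {-1<..<1} x *\<^sub>R (f x * ultra_weight l x)" 0])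
     (auto simp: set_lebesgue_integral_def ultra_weight_def indicator_def intro!: Bochner_Integration.integral_cong)

lemma integral_ultra_measure_odd:
  fixes f :: "real \<Rightarrow> real"
  assumes [measurable]: "f \<in> borel_measurable borel" and "\<And>x. f (- x) = - f x"
  shows "integral\<^sup>L (ultra_measure l) f = 0"
  using integral_ultra_measure_minus[OF assms(1), of l] by (simp add: assms(2) neg_equal_zero)

text \<open>Write x^2 = 1 - (1 - x^2) and absorb the second summand into the order.\<close>

lemma integral_ultra_measure_mult_square:
  assumes "l > -1/2" and f: "continuous_on UNIV f"
  shows "(\<integral>x. x\<^sup>2 * f x \<partial>ultra_measure l) = integral\<^sup>L (ultra_measure l) f - integral\<^sup>L (ultra_measure (l + 1)) f"
proof -
  have m: "f \<in> borel_measurable borel" using borel_measurable_continuous_onI[OF f] .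
  have "integral\<^sup>L (ultra_measure (l + 1)) f = (\<integral>x. f x * (1 - x\<^sup>2) powr 1 \<partial>ultra_measure l)"
    using integral_ultra_measure_shift[OF m, of l 1] by simp
  also have "\<dots> = (\<integral>x. f x - x\<^sup>2 * f x \<partial>ultra_measure l)"
  proof (rule integral_cong_AE)
    show "AE x in ultra_measure l. f x * (1 - x\<^sup>2) powr 1 = f x - x\<^sup>2 * f x"
      using AE_ultra_measure
    proof eventually_elim
      case (elim x)
      then show ?case using one_minus_square_pos[OF elim] by (simp add: algebra_simps)
    qed
  qed (use m in measurable)
  also have "\<dots> = integral\<^sup>L (ultra_measure l) f - (\<integral>x. x\<^sup>2 * f x \<partial>ultra_measure l)"
    using assms by (intro Bochner_Integration.integral_diff integrable_ultra_measure_continuous continuous_intros)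
  finally show ?thesis by simp
qed

section \<open>Moments and orthogonality\<close>

lemma integral_gegenbauer_rec:
  assumes lam: "lam > 0" and l: "l > -1/2" and f: "continuous_on UNIV f"
  shows "real (n + 2) * (\<integral>x. f x * gegenbauer lam (n + 2) x \<partial>ultra_measure l)
       = 2 * (real n + 1 + lam) * (\<integral>x. f x * x * gegenbauer lam (n + 1) x \<partial>ultra_measure l)
         - (real n + 2 * lam) * (\<integral>x. f x * gegenbauer lam n x \<partial>ultra_measure l)"
proof -
  have I: "integrable (ultra_measure l) (\<lambda>x. f x * x * gegenbauer lam (n + 1) x)"
    "integrable (ultra_measure l) (\<lambda>x. f x * gegenbauer lam n x)"
    using l f by (auto intro!: integrable_ultra_measure_continuous continuous_intros)
  have "real (n + 2) * (\<integral>x. f x * gegenbauer lam (n + 2) x \<partial>ultra_measure l)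
      = (\<integral>x. f x * (real (n + 2) * gegenbauer lam (n + 2) x) \<partial>ultra_measure l)"
    by (subst integral_mult_right_zero[symmetric]) (simp only: mult_ac)
  also have "\<dots> = (\<integral>x. 2 * (real n + 1 + lam) * (f x * x * gegenbauer lam (n + 1) x)
       - (real n + 2 * lam) * (f x * gegenbauer lam n x) \<partial>ultra_measure l)"
    unfolding gegenbauer_rec[OF lam] by (simp only: right_diff_distrib mult_ac)
  also have "\<dots> = 2 * (real n + 1 + lam) * (\<integral>x. f x * x * gegenbauer lam (n + 1) x \<partial>ultra_measure l)
         - (real n + 2 * lam) * (\<integral>x. f x * gegenbauer lam n x \<partial>ultra_measure l)"
    using I by (subst Bochner_Integration.integral_diff) auto
  finally show ?thesis .
qed

text \<open>A factor \<open>x\<^sup>2\<close> is absorbed by a shift of \<open>l\<close>, so the recurrence closes on this pair of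
  formulas when \<open>l\<close> is kept arbitrary.\<close>

lemma gegenbauer_moments:
  assumes lam: "lam > 0" and "l > -1/2"
  shows "integral\<^sup>L (ultra_measure l) (gegenbauer lam (2*m))
           = pochhammer lam m * pochhammer (lam - l) m / fact m * (sqrt pi * Gamma (l + 1/2) / Gamma (l + 1 + m))"
    and "(\<integral>x. x * gegenbauer lam (2*m+1) x \<partial>ultra_measure l)
           = pochhammer lam (Suc m) * pochhammer (lam - l) m / fact m * (sqrt pi * Gamma (l + 1/2) / Gamma (l + 2 + m))"
  using assms(2)
proof (induction m arbitrary: l)
  case 0
  {
    case 1
    then show ?case using lam measure_ultra_measure[of l] by simp
  next
    case 2
    have l: "l > -1/2" by fact
    have c1: "continuous_on UNIV (\<lambda>x::real. 1::real)" by simp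
    have g: "Gamma (l + 2) = (l + 1) * Gamma (l + 1)" "Gamma (l + 1 + 1/2) = (l + 1/2) * Gamma (l + 1/2)"
      using Gamma_plus1_pos[of "l + 1"] Gamma_plus1_pos[of "l + 1/2"] l by (auto simp: add_ac)
    have p: "Gamma (l + 1) > 0" "l + 1 > 0" using l by (auto intro!: Gamma_real_pos)
    have "(\<integral>x. x * gegenbauer lam (2*0+1) x \<partial>ultra_measure l) = (\<integral>x. 2 * lam * (x\<^sup>2 * 1) \<partial>ultra_measure l)"
      by (intro Bochner_Integration.integral_cong) (auto simp: gegenbauer_1 lam power2_eq_square)
    also have "\<dots> = 2 * lam * (\<integral>x. x\<^sup>2 * 1 \<partial>ultra_measure l)"
      by (rule integral_mult_right_zero)
    also have "\<dots> = 2 * lam * (sqrt pi * Gamma (l + 1/2) / Gamma (l + 1) - sqrt pi * Gamma (l + 1 + 1/2) / Gamma (l + 1 + 1))"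
      using integral_ultra_measure_mult_square[OF l c1] measure_ultra_measure[OF l] measure_ultra_measure[of "l + 1"] l
      by simp
    also have "\<dots> = 2 * lam * (sqrt pi * Gamma (l + 1/2) / Gamma (l + 1) - sqrt pi * ((l + 1/2) * Gamma (l + 1/2)) / ((l + 1) * Gamma (l + 1)))"
      unfolding g(1)[symmetric] g(2) by (simp add: add.commute)
    also have "\<dots> = lam * (sqrt pi * Gamma (l + 1/2) / Gamma (l + 2))"
      unfolding g using p by (simp add: divide_simps) (simp add: algebra_simps)
    finally show ?case by simp
  }
next
  case (Suc m)
  \<comment> \<open>Stated for every order, since the odd formula below calls it at both l and l +
    1.\<close>
  have E: "integral\<^sup>L (ultra_measure l) (gegenbauer lam (2 * Suc m))
         = pochhammer lam (Suc m) * pochhammer (lam - l) (Suc m) / fact (Suc m)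
           * (sqrt pi * Gamma (l + 1/2) / Gamma (l + 1 + Suc m))" if l: "l > -1/2" for l
  proof -
    define K where "K = pochhammer lam m * pochhammer (lam - l) m / fact m * (sqrt pi * Gamma (l + 1/2) / Gamma (l + 2 + m))"
    have g: "Gamma (l + 2 + m) = (l + 1 + m) * Gamma (l + 1 + m)"
      using Gamma_plus1_pos[of "l + 1 + m"] l by (auto simp: add_ac)
    have p: "Gamma (l + 1 + m) > 0" "l + 1 + m > 0" using l by (auto intro!: Gamma_real_pos)
    have "integral\<^sup>L (ultra_measure l) (gegenbauer lam (2*m)) = (l + 1 + m) * K"
      unfolding Suc.IH(1)[OF l] K_def g using p by simp
    moreover have "(\<integral>x. x * gegenbauer lam (2*m+1) x \<partial>ultra_measure l) = (lam + m) * K"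
      unfolding Suc.IH(2)[OF l] K_def by (simp add: pochhammer_Suc)
    moreover have "real (2 * m + 2) * (\<integral>x. gegenbauer lam (2 * Suc m) x \<partial>ultra_measure l)
       = 2 * (real (2 * m) + 1 + lam) * (\<integral>x. x * gegenbauer lam (2 * m + 1) x \<partial>ultra_measure l)
         - (real (2 * m) + 2 * lam) * (\<integral>x. gegenbauer lam (2 * m) x \<partial>ultra_measure l)"
      using integral_gegenbauer_rec[OF lam l, of "\<lambda>x. 1" "2 * m"] by simp
    ultimately have "2 * (real m + 1) * (\<integral>x. gegenbauer lam (2 * Suc m) x \<partial>ultra_measure l)
       = 2 * (lam + m) * (lam - l + m) * K"
      by (simp add: algebra_simps)
    then have "(\<integral>x. gegenbauer lam (2 * Suc m) x \<partial>ultra_measure l) = (lam + m) * (lam - l + m) * K / (real m + 1)"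
      by (simp add: field_simps)
    also have "\<dots> = pochhammer lam (Suc m) * pochhammer (lam - l) (Suc m) / fact (Suc m)
           * (sqrt pi * Gamma (l + 1/2) / Gamma (l + 1 + Suc m))"
      by (simp add: K_def pochhammer_Suc add_ac) (simp add: mult_ac)
    finally show ?thesis .
  qed
  {
    case 1
    then show ?case by (rule E)
  next
    case 2
    have l: "l > -1/2" by fact
    define b where "b = lam - l"
    \<comment> \<open>Normalised so that the three moments entering the recurrence are K times
      polynomials in lam, l and m; what remains is a polynomial identity.\<close>
    define K where "K = pochhammer lam (Suc m) * pochhammer b m / fact (Suc m) * (sqrt pi * Gamma (l + 1/2) / Gamma (l + 3 + m))"
    have g: "Gamma (l + 3 + m) = (l + 2 + m) * Gamma (l + 2 + m)" "Gamma (l + 3/2) = (l + 1/2) * Gamma (l + 1/2)"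
      using Gamma_plus1_pos[of "l + 2 + m"] Gamma_plus1_pos[of "l + 1/2"] l by (auto simp: add_ac)
    have p: "Gamma (l + 2 + m) > 0" "l + 2 + m > 0" using l by (auto intro!: Gamma_real_pos)
    have E1: "integral\<^sup>L (ultra_measure l) (gegenbauer lam (2 * Suc m)) = (b + m) * (l + 2 + m) * K"
    proof -
      have e: "l + 1 + real (Suc m) = l + 2 + m" by simp
      show ?thesis unfolding E[OF l] K_def g e b_def[symmetric] using p by (simp add: pochhammer_Suc mult_ac)
    qed
    have E2: "integral\<^sup>L (ultra_measure (l + 1)) (gegenbauer lam (2 * Suc m)) = (b - 1) * (l + 1/2) * K"
    proof -
      have e: "l + 1 + 1 + real (Suc m) = l + 3 + m" "lam - (l + 1) = b - 1" "l + 1 + 1/2 = l + 3/2" by (simp_all add: b_def)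
      have l': "l + 1 > -1/2" using l by simp
      show ?thesis unfolding E[OF l'] K_def e g(2) pochhammer_rec[of "b - 1"] by simp
    qed
    have O: "(\<integral>x. x * gegenbauer lam (2*m+1) x \<partial>ultra_measure l) = (m + 1) * (l + 2 + m) * K"
      unfolding Suc.IH(2)[OF l] K_def b_def[symmetric] g using p by (simp add: divide_simps)
    have c: "continuous_on UNIV (gegenbauer lam (2 * Suc m))" by (intro continuous_intros)
    have "real (2 * m + 3) * (\<integral>x. x * gegenbauer lam (2 * Suc m + 1) x \<partial>ultra_measure l)
       = 2 * (real (2 * m) + 2 + lam) * (\<integral>x. x\<^sup>2 * gegenbauer lam (2 * Suc m) x \<partial>ultra_measure l)
         - (real (2 * m) + 1 + 2 * lam) * (\<integral>x. x * gegenbauer lam (2 * m + 1) x \<partial>ultra_measure l)"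
      using integral_gegenbauer_rec[OF lam l, of "\<lambda>x. x" "2 * m + 1"] by (simp add: power2_eq_square eval_nat_numeral add_ac)
    also have "\<dots> = (2 * (2 * real m + 2 + lam) * ((b + m) * (l + 2 + m) - (b - 1) * (l + 1/2))
        - (2 * real m + 1 + 2 * lam) * ((m + 1) * (l + 2 + m))) * K"
      unfolding integral_ultra_measure_mult_square[OF l c] E1 E2 O by (simp add: algebra_simps)
    also have "\<dots> = (2 * real m + 3) * ((lam + m + 1) * (b + m) * K)"
      unfolding b_def by (simp add: field_simps)
    finally have "(\<integral>x. x * gegenbauer lam (2 * Suc m + 1) x \<partial>ultra_measure l) = (lam + m + 1) * (b + m) * K"
      by (simp add: add_pos_nonneg)
    also have "\<dots> = pochhammer lam (Suc (Suc m)) * pochhammer (lam - l) (Suc m) / fact (Suc m)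
           * (sqrt pi * Gamma (l + 1/2) / Gamma (l + 2 + Suc m))"
      by (simp add: K_def b_def[symmetric] pochhammer_Suc[of _ "Suc m"] pochhammer_Suc[of b] add_ac)
    finally show ?case .
  }
qed

lemma integral_gegenbauer_odd:
  "integral\<^sup>L (ultra_measure l) (gegenbauer lam (2*m+1)) = 0"
  by (rule integral_ultra_measure_odd)
     (auto simp: gegenbauer_minus intro!: borel_measurable_continuous_onI continuous_intros)

lemma integral_mult_x_gegenbauer_even:
  "(\<integral>x. x * gegenbauer lam (2*m) x \<partial>ultra_measure l) = 0"
  by (rule integral_ultra_measure_odd)
     (auto simp: gegenbauer_minus intro!: borel_measurable_continuous_onI continuous_intros)

text \<open>At l = lam the factor \<open>pochhammer (lam - l) m\<close> of the even moments vanishes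
  for m > 0; odd degrees vanish by parity.\<close>

lemma integral_gegenbauer_eq_0:
  assumes "lam > 0" "n > 0"
  shows "integral\<^sup>L (ultra_measure lam) (gegenbauer lam n) = 0"
proof (cases "even n")
  case True
  then obtain m where "n = 2 * m" by auto
  then show ?thesis using assms gegenbauer_moments(1)[of lam lam m] by (simp add: pochhammer_0_left)
next
  case False
  then obtain m where "n = 2 * m + 1" using oddE by blast
  then show ?thesis using integral_gegenbauer_odd by simp
qed

section \<open>Multiplication by x in the Gegenbauer basis\<close>

definition gegenbauer_up :: "real \<Rightarrow> nat \<Rightarrow> real" where
  "gegenbauer_up lam n = (real n + 1) / (2 * (real n + lam))"

text \<open>The value 0 at n = 0 neutralises the truncated index n - 1. The quotient itself would
  give (2 lam - 1) / (2 lam) there, which is negative for lam < 1/2.\<close>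

definition gegenbauer_down :: "real \<Rightarrow> nat \<Rightarrow> real" where
  "gegenbauer_down lam n = (if n = 0 then 0 else (real n - 1 + 2 * lam) / (2 * (real n + lam)))"

lemma gegenbauer_up_pos: "lam > 0 \<Longrightarrow> gegenbauer_up lam n > 0"
  by (simp add: gegenbauer_up_def add_nonneg_pos)

lemma gegenbauer_down_pos: "lam > 0 \<Longrightarrow> n > 0 \<Longrightarrow> gegenbauer_down lam n > 0"
  by (simp add: gegenbauer_down_def add_nonneg_pos)

lemma gegenbauer_down_nonneg: "lam > 0 \<Longrightarrow> gegenbauer_down lam n \<ge> 0"
  by (cases n) (auto simp: gegenbauer_down_def)

lemma mult_x_gegenbauer:
  assumes "lam > 0"
  shows "x * gegenbauer lam n x = gegenbauer_up lam n * gegenbauer lam (Suc n) x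
           + gegenbauer_down lam n * gegenbauer lam (n - 1) x"
proof (cases n)
  case 0
  then show ?thesis using gegenbauer_mult_x_0[OF assms, of x] by (simp add: gegenbauer_up_def gegenbauer_down_def)
next
  case (Suc k)
  then show ?thesis using gegenbauer_mult_x_Suc[OF assms, of x k]
    by (simp add: gegenbauer_up_def gegenbauer_down_def add_ac)
qed

definition gegenbauer_inner :: "real \<Rightarrow> nat \<Rightarrow> nat \<Rightarrow> real" where
  "gegenbauer_inner lam n m = (\<integral>x. gegenbauer lam n x * gegenbauer lam m x \<partial>ultra_measure lam)"

lemma gegenbauer_inner_commute: "gegenbauer_inner lam n m = gegenbauer_inner lam m n"
  by (simp add: gegenbauer_inner_def mult.commute)

lemma integral_mult_x_gegenbauer:
  assumes "lam > 0" and f: "continuous_on UNIV f" and l: "l > -1/2"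
  shows "(\<integral>x. x * gegenbauer lam n x * f x \<partial>ultra_measure l)
       = gegenbauer_up lam n * (\<integral>x. gegenbauer lam (Suc n) x * f x \<partial>ultra_measure l)
         + gegenbauer_down lam n * (\<integral>x. gegenbauer lam (n - 1) x * f x \<partial>ultra_measure l)"
proof -
  have "(\<integral>x. x * gegenbauer lam n x * f x \<partial>ultra_measure l)
      = (\<integral>x. gegenbauer_up lam n * (gegenbauer lam (Suc n) x * f x)
            + gegenbauer_down lam n * (gegenbauer lam (n - 1) x * f x) \<partial>ultra_measure l)"
    unfolding mult_x_gegenbauer[OF assms(1)] by (simp only: distrib_right mult.assoc)
  also have "\<dots> = (\<integral>x. gegenbauer_up lam n * (gegenbauer lam (Suc n) x * f x) \<partial>ultra_measure l)
            + (\<integral>x. gegenbauer_down lam n * (gegenbauer lam (n - 1) x * f x) \<partial>ultra_measure l)"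
    by (intro Bochner_Integration.integral_add integrable_ultra_measure_continuous l continuous_intros f)
  finally show ?thesis by simp
qed

text \<open>Multiplication by x is symmetric for the inner product: expand x C_n C_m once through x
  C_n and once through x C_m.\<close>

lemma gegenbauer_inner_symmetric_rec:
  assumes "lam > 0"
  shows "gegenbauer_up lam n * gegenbauer_inner lam (Suc n) m + gegenbauer_down lam n * gegenbauer_inner lam (n - 1) m
       = gegenbauer_up lam m * gegenbauer_inner lam n (Suc m) + gegenbauer_down lam m * gegenbauer_inner lam n (m - 1)"
proof -
  have l: "lam > -1/2" using assms by simp
  have c: "continuous_on UNIV (gegenbauer lam n)" for n by (intro continuous_intros)
  have "(\<integral>x. x * gegenbauer lam n x * gegenbauer lam m x \<partial>ultra_measure lam)
      = (\<integral>x. x * gegenbauer lam m x * gegenbauer lam n x \<partial>ultra_measure lam)" by (simp only: mult_ac)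
  then show ?thesis
    unfolding integral_mult_x_gegenbauer[OF assms c l]
    by (simp add: gegenbauer_inner_def mult.commute)
qed

text \<open>Induction on the smaller index. The base is the vanishing mean; the symmetry relation
  expresses the product with index k + 1 through products with indices k and k - 1, and k + 1 < n
  keeps n - 1 above k.\<close>

lemma gegenbauer_orthogonal_less:
  assumes "lam > 0" "m < n"
  shows "gegenbauer_inner lam n m = 0"
  using assms(2)
proof (induction m arbitrary: n rule: less_induct)
  case (less m)
  show ?case
  proof (cases m)
    case 0
    then show ?thesis using integral_gegenbauer_eq_0[OF assms(1)] less.prems assms(1)
      by (simp add: gegenbauer_inner_def)
  next
    case (Suc k)
    have "gegenbauer_inner lam (Suc n) k = 0" "gegenbauer_inner lam (n - 1) k = 0"
      using less Suc by auto
    \<comment> \<open>For k = 0 the index k - 1 is 0 again, but its coefficient is zero.\<close>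
    moreover have "gegenbauer_down lam k * gegenbauer_inner lam n (k - 1) = 0"
      using less.IH[of "k - 1" n] less.prems Suc by (cases k) (auto simp: gegenbauer_down_def)
    ultimately have "gegenbauer_up lam k * gegenbauer_inner lam n (Suc k) = 0"
      using gegenbauer_inner_symmetric_rec[OF assms(1), of n k] by (metis add_0 add_0_right mult_zero_right)
    then show ?thesis using gegenbauer_up_pos[OF assms(1), of k] Suc by simp
  qed
qed

lemma gegenbauer_orthogonal:
  assumes "lam > 0" "m \<noteq> n"
  shows "gegenbauer_inner lam n m = 0"
  using gegenbauer_orthogonal_less[OF assms(1), of m n] gegenbauer_orthogonal_less[OF assms(1), of n m]
    gegenbauer_inner_commute[of lam n m] assms(2) by (cases m n rule: linorder_cases) auto

text \<open>Taking neighbouring indices in the symmetry relation leaves only the two diagonal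
  products, so each squared norm is a positive multiple of the previous one.\<close>

lemma gegenbauer_inner_self_pos:
  assumes "lam > 0"
  shows "gegenbauer_inner lam n n > 0"
proof (induction n)
  case 0
  have "gegenbauer_inner lam 0 0 = sqrt pi * Gamma (lam + 1/2) / Gamma (lam + 1)"
    using assms measure_ultra_measure[of lam] by (simp add: gegenbauer_inner_def)
  also have "\<dots> > 0" using assms by (auto intro!: divide_pos_pos mult_pos_pos Gamma_real_pos)
  finally show ?case .
next
  case (Suc n)
  have "gegenbauer_down lam n * gegenbauer_inner lam (n - 1) (Suc n) = 0"
    "gegenbauer_inner lam n (Suc (Suc n)) = 0"
    using gegenbauer_orthogonal[OF assms] by auto
  then have "gegenbauer_up lam n * gegenbauer_inner lam (Suc n) (Suc n)
       = gegenbauer_down lam (Suc n) * gegenbauer_inner lam n n"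
    using gegenbauer_inner_symmetric_rec[OF assms, of n "Suc n"]
    by (metis add_0 add_0_right mult_zero_right diff_Suc_1)
  also have "\<dots> > 0" using Suc gegenbauer_down_pos[OF assms, of "Suc n"] by simp
  finally show ?case using gegenbauer_up_pos[OF assms, of n] by (simp add: zero_less_mult_iff)
qed

section \<open>Nonnegative combinations of Gegenbauer polynomials\<close>

text \<open>The finite nonnegative combinations, kept as functions. Closure properties then need no
  bookkeeping of coefficients, which orthogonality recovers as integrals when they are
  wanted.\<close>

inductive_set gegenbauer_cone :: "real \<Rightarrow> (real \<Rightarrow> real) set" for lam :: real where
  zero: "(\<lambda>x. 0) \<in> gegenbauer_cone lam"
| add: "f \<in> gegenbauer_cone lam \<Longrightarrow> c \<ge> 0 \<Longrightarrow> (\<lambda>x. f x + c * gegenbauer lam n x) \<in> gegenbauer_cone lam"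

lemma gegenbauer_in_cone: "gegenbauer lam n \<in> gegenbauer_cone lam"
  using gegenbauer_cone.add[OF gegenbauer_cone.zero, of 1 lam n] by simp

lemma gegenbauer_cone_plus:
  assumes "f \<in> gegenbauer_cone lam" "g \<in> gegenbauer_cone lam"
  shows "(\<lambda>x. f x + g x) \<in> gegenbauer_cone lam"
  using assms(2)
proof induction
  case zero
  then show ?case using assms(1) by simp
next
  case (add g c n)
  then show ?case using gegenbauer_cone.add[of "\<lambda>x. f x + g x" lam c n] by (simp add: add.assoc)
qed

lemma gegenbauer_cone_scale:
  assumes "f \<in> gegenbauer_cone lam" "a \<ge> 0"
  shows "(\<lambda>x. a * f x) \<in> gegenbauer_cone lam"
  using assms(1)
proof induction
  case zero
  then show ?case using gegenbauer_cone.zero by simp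
next
  case (add g c n)
  then show ?case using gegenbauer_cone.add[of "\<lambda>x. a * g x" lam "a * c" n] assms(2)
    by (simp add: distrib_left mult.assoc)
qed

lemma gegenbauer_cone_mult_x:
  assumes "lam > 0" "f \<in> gegenbauer_cone lam"
  shows "(\<lambda>x. x * f x) \<in> gegenbauer_cone lam"
  using assms(2)
proof induction
  case zero
  then show ?case using gegenbauer_cone.zero by simp
next
  case (add g c n)
  have "(\<lambda>x. x * g x + (c * gegenbauer_up lam n) * gegenbauer lam (Suc n) x
       + (c * gegenbauer_down lam n) * gegenbauer lam (n - 1) x) \<in> gegenbauer_cone lam"
    using add gegenbauer_up_pos[OF assms(1), of n] gegenbauer_down_nonneg[OF assms(1), of n]
    by (intro gegenbauer_cone.add) auto
  also have "(\<lambda>x. x * g x + (c * gegenbauer_up lam n) * gegenbauer lam (Suc n) x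
       + (c * gegenbauer_down lam n) * gegenbauer lam (n - 1) x) = (\<lambda>x. x * (g x + c * gegenbauer lam n x))"
  proof
    fix x
    have "x * (g x + c * gegenbauer lam n x) = x * g x + c * (x * gegenbauer lam n x)"
      by (simp add: algebra_simps)
    then show "x * g x + (c * gegenbauer_up lam n) * gegenbauer lam (Suc n) x
       + (c * gegenbauer_down lam n) * gegenbauer lam (n - 1) x = x * (g x + c * gegenbauer lam n x)"
      unfolding mult_x_gegenbauer[OF assms(1), of x n] by (simp add: algebra_simps)
  qed
  finally show ?case .
qed

lemma gegenbauer_cone_mult_power:
  assumes "lam > 0" "f \<in> gegenbauer_cone lam"
  shows "(\<lambda>x. x ^ k * f x) \<in> gegenbauer_cone lam"
proof (induction k)
  case (Suc k)
  then show ?case using gegenbauer_cone_mult_x[OF assms(1) Suc] by (simp add: mult.assoc)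
qed (use assms in simp)

lemma gegenbauer_cone_sum:
  assumes "finite A" "\<And>i. i \<in> A \<Longrightarrow> f i \<in> gegenbauer_cone lam"
  shows "(\<lambda>x. \<Sum>i\<in>A. f i x) \<in> gegenbauer_cone lam"
  using assms by (induction A) (auto intro: gegenbauer_cone.zero gegenbauer_cone_plus)

lemma gegenbauer_cone_continuous:
  "f \<in> gegenbauer_cone lam \<Longrightarrow> continuous_on UNIV f"
  by (induction rule: gegenbauer_cone.induct) (auto intro!: continuous_intros)

lemma integral_cone_add:
  assumes "lam > 0" "f \<in> gegenbauer_cone lam"
  shows "(\<integral>x. (f x + c * gegenbauer lam n x) * gegenbauer lam m x \<partial>ultra_measure lam)
    = (\<integral>x. f x * gegenbauer lam m x \<partial>ultra_measure lam) + (if m = n then c * gegenbauer_inner lam n n else 0)"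
proof -
  have l: "lam > -1/2" using assms by simp
  have "(\<integral>x. (f x + c * gegenbauer lam n x) * gegenbauer lam m x \<partial>ultra_measure lam)
    = (\<integral>x. f x * gegenbauer lam m x + c * (gegenbauer lam n x * gegenbauer lam m x) \<partial>ultra_measure lam)"
    by (simp only: distrib_right mult.assoc)
  also have "\<dots> = (\<integral>x. f x * gegenbauer lam m x \<partial>ultra_measure lam) + (\<integral>x. c * (gegenbauer lam n x * gegenbauer lam m x) \<partial>ultra_measure lam)"
    by (intro Bochner_Integration.integral_add integrable_ultra_measure_continuous l continuous_intros
        gegenbauer_cone_continuous[OF assms(2)])
  also have "(\<integral>x. c * (gegenbauer lam n x * gegenbauer lam m x) \<partial>ultra_measure lam) = c * gegenbauer_inner lam n m"
    by (simp add: gegenbauer_inner_def)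
  finally show ?thesis using gegenbauer_orthogonal[OF assms(1), of m n] by simp
qed

lemma integral_cone_nonneg:
  assumes "lam > 0" "f \<in> gegenbauer_cone lam"
  shows "0 \<le> (\<integral>x. f x * gegenbauer lam m x \<partial>ultra_measure lam)"
  using assms(2)
proof induction
  case (add f c n)
  then show ?case using gegenbauer_inner_self_pos[OF assms(1), of n] by (simp add: integral_cone_add[OF assms(1)])
qed simp

text \<open>The signs of the coefficients are forgotten here: the purpose is to expand monomials for
  the density argument.\<close>

lemma cone_expansion:
  assumes "f \<in> gegenbauer_cone lam"
  shows "\<exists>y N. f = (\<lambda>x. \<Sum>m\<le>N. y m * gegenbauer lam m x)"
  using assms
proof induction
  case zero
  show ?case by (intro exI[of _ "\<lambda>_. 0"]) simp
next
  case (add f c n)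
  then obtain y N where f: "f = (\<lambda>x. \<Sum>m\<le>N. y m * gegenbauer lam m x)" by blast
  define y' where "y' m = (if m \<le> N then y m else 0) + (if m = n then c else 0)" for m
  have "f x + c * gegenbauer lam n x = (\<Sum>m\<le>max N n. y' m * gegenbauer lam m x)" for x
  proof -
    have "(\<Sum>m\<le>max N n. y' m * gegenbauer lam m x)
       = (\<Sum>m\<le>max N n. if m \<le> N then y m * gegenbauer lam m x else 0)
         + (\<Sum>m\<le>max N n. if m = n then c * gegenbauer lam n x else 0)"
      unfolding sum.distrib[symmetric] by (intro sum.cong) (auto simp: y'_def algebra_simps)
    also have "(\<Sum>m\<le>max N n. if m \<le> N then y m * gegenbauer lam m x else 0) = f x"
      unfolding f by (intro sum.mono_neutral_cong_right) auto
    finally show ?thesis by simp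
  qed
  then show ?case by blast
qed

text \<open>The quotients are the expansion coefficients of f, taken in the measure of order lam,
  while g is paired in the measure of order l. For large N there is equality, f being a finite
  combination; for smaller N nonnegative terms are dropped. This replaces an infinite expansion of W
  p.\<close>

lemma cone_coefficients_pairing_le:
  assumes "lam > 0" "f \<in> gegenbauer_cone lam" and g: "continuous_on UNIV g" and l: "l > -1/2"
    and nonneg: "\<And>n. 0 \<le> (\<integral>x. gegenbauer lam n x * g x \<partial>ultra_measure l)"
  shows "(\<Sum>m\<le>N. (\<integral>x. f x * gegenbauer lam m x \<partial>ultra_measure lam) / gegenbauer_inner lam m m
            * (\<integral>x. gegenbauer lam m x * g x \<partial>ultra_measure l))
         \<le> (\<integral>x. f x * g x \<partial>ultra_measure l)"
  using assms(2)
proof induction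
  case (add f c n)
  define p where "p m = (\<integral>x. gegenbauer lam m x * g x \<partial>ultra_measure l)" for m
  have h: "gegenbauer_inner lam m m \<noteq> 0" for m using gegenbauer_inner_self_pos[OF assms(1), of m] by simp
  have "(\<Sum>m\<le>N. (\<integral>x. (f x + c * gegenbauer lam n x) * gegenbauer lam m x \<partial>ultra_measure lam) / gegenbauer_inner lam m m * p m)
     = (\<Sum>m\<le>N. (\<integral>x. f x * gegenbauer lam m x \<partial>ultra_measure lam) / gegenbauer_inner lam m m * p m
          + (if m = n then c * p n else 0))"
    unfolding integral_cone_add[OF assms(1) add.hyps(1)] by (intro sum.cong) (auto simp: h field_simps)
  also have "\<dots> = (\<Sum>m\<le>N. (\<integral>x. f x * gegenbauer lam m x \<partial>ultra_measure lam) / gegenbauer_inner lam m m * p m)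
       + (if n \<le> N then c * p n else 0)"
    by (simp add: sum.distrib)
  also have "\<dots> \<le> (\<integral>x. f x * g x \<partial>ultra_measure l) + c * p n"
    using add.IH mult_nonneg_nonneg[OF add.hyps(2) nonneg[of n]]
    by (intro add_mono) (auto simp: p_def)
  also have "\<dots> = (\<integral>x. f x * g x \<partial>ultra_measure l) + (\<integral>x. c * (gegenbauer lam n x * g x) \<partial>ultra_measure l)"
    by (simp add: p_def)
  also have "\<dots> = (\<integral>x. f x * g x + c * (gegenbauer lam n x * g x) \<partial>ultra_measure l)"
    by (intro Bochner_Integration.integral_add[symmetric] integrable_ultra_measure_continuous l continuous_intros g
        gegenbauer_cone_continuous[OF add.hyps(1)])
  also have "\<dots> = (\<integral>x. (f x + c * gegenbauer lam n x) * g x \<partial>ultra_measure l)"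
    by (simp only: distrib_right mult.assoc)
  finally show ?case by (simp add: p_def)
qed simp

section \<open>Power series of the Hardy weight\<close>

definition binomial_partial :: "real \<Rightarrow> nat \<Rightarrow> real \<Rightarrow> real" where
  "binomial_partial s K x = (\<Sum>k<K. pochhammer s k / fact k * x ^ (2 * k))"

lemma binomial_partial_sums:
  fixes x s :: real
  assumes "x \<in> {-1<..<1}"
  shows "(\<lambda>k. pochhammer s k / fact k * x ^ (2 * k)) sums ((1 - x\<^sup>2) powr (- s))"
proof -
  have "\<bar>- x\<^sup>2\<bar> < 1" using one_minus_square_pos[OF assms] by simp
  from gen_binomial_real[OF this, of "- s"]
  have "(\<lambda>k. (- s gchoose k) * (- x\<^sup>2) ^ k) sums ((1 - x\<^sup>2) powr (- s))" by simp
  moreover have "(- s gchoose k) * (- x\<^sup>2) ^ k = pochhammer s k / fact k * x ^ (2 * k)" for k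
    by (simp add: gbinomial_pochhammer power_minus[of "x\<^sup>2"] power_mult)
  ultimately show ?thesis by simp
qed

lemma binomial_partial_mult_in_cone:
  assumes "lam > 0" "s > 0" "f \<in> gegenbauer_cone lam"
  shows "(\<lambda>x. binomial_partial s K x * f x) \<in> gegenbauer_cone lam"
proof -
  have "(\<lambda>x. \<Sum>k<K. pochhammer s k / fact k * (x ^ (2 * k) * f x)) \<in> gegenbauer_cone lam"
    using assms by (intro gegenbauer_cone_sum gegenbauer_cone_scale gegenbauer_cone_mult_power)
      (auto intro!: divide_nonneg_pos pochhammer_nonneg)
  then show ?thesis by (simp add: binomial_partial_def sum_distrib_right mult.assoc)
qed

text \<open>For s > 0 the series has nonnegative terms, so its partial sums lie between 0 and the
  full weight. The majorant |f| (1 - x^2)^(-s) is integrable because l - s > -1/2.\<close>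

lemma integral_binomial_partial_tendsto:
  assumes "s > 0" "l - s > -1/2" and f: "continuous_on UNIV f"
  shows "(\<lambda>K. \<integral>x. binomial_partial s K x * f x \<partial>ultra_measure l) \<longlonglongrightarrow> integral\<^sup>L (ultra_measure (l - s)) f"
proof -
  have [measurable]: "f \<in> borel_measurable borel" using borel_measurable_continuous_onI[OF f] .
  have [measurable]: "binomial_partial s K \<in> borel_measurable borel" for K
    unfolding binomial_partial_def by measurable
  have "(\<lambda>K. \<integral>x. binomial_partial s K x * f x \<partial>ultra_measure l) \<longlonglongrightarrow> (\<integral>x. f x * (1 - x\<^sup>2) powr (- s) \<partial>ultra_measure l)"
  proof (rule integral_dominated_convergence[where w = "\<lambda>x. norm (f x) * (1 - x\<^sup>2) powr (- s)"])
    show "integrable (ultra_measure l) (\<lambda>x. norm (f x) * (1 - x\<^sup>2) powr (- s))"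
      using integrable_ultra_measure_shift[of "\<lambda>x. norm (f x)" l "- s"] assms
      by (simp add: integrable_ultra_measure_continuous)
    show "AE x in ultra_measure l. (\<lambda>K. binomial_partial s K x * f x) \<longlonglongrightarrow> f x * (1 - x\<^sup>2) powr (- s)"
      using AE_ultra_measure
    proof eventually_elim
      case (elim x)
      then show ?case
        using tendsto_mult[OF binomial_partial_sums[OF elim, of s, unfolded sums_def] tendsto_const[of "f x"]]
        by (simp add: binomial_partial_def mult.commute)
    qed
    show "AE x in ultra_measure l. norm (binomial_partial s K x * f x) \<le> norm (f x) * (1 - x\<^sup>2) powr (- s)" for K
      using AE_ultra_measure
    proof eventually_elim
      case (elim x)
      have nn: "pochhammer s k / fact k * x ^ (2 * k) \<ge> 0" for k
        using assms(1) by (auto intro!: mult_nonneg_nonneg divide_nonneg_pos pochhammer_nonneg)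
      have "binomial_partial s K x \<ge> 0" unfolding binomial_partial_def by (intro sum_nonneg nn)
      moreover have "binomial_partial s K x \<le> (1 - x\<^sup>2) powr (- s)"
        unfolding binomial_partial_def sums_unique[OF binomial_partial_sums[OF elim, of s]]
        by (intro sum_le_suminf sums_summable[OF binomial_partial_sums[OF elim]] nn) auto
      ultimately show ?case by (simp add: abs_mult mult.commute mult_left_mono)
    qed
  qed auto
  then show ?thesis using integral_ultra_measure_shift[of f l "- s"] by simp
qed

section \<open>The Hardy inequality for polynomials\<close>

text \<open>Apply the weighted AM-GM inequality to t n * t m with weights q m / q n and q n / q m.
  By symmetry of W both halves have the same sum, and each row sum is then controlled by
  \<open>bound\<close>.\<close>

lemma schur_test_finite:
  fixes W :: "nat \<Rightarrow> nat \<Rightarrow> real"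
  assumes sym: "\<And>n m. W n m = W m n" and nn: "\<And>n m. W n m \<ge> 0" and q: "\<And>n. q n > 0"
    and bound: "\<And>n. n \<in> A \<Longrightarrow> (\<Sum>m\<in>A. W n m * q m) \<le> B n * q n"
  shows "(\<Sum>n\<in>A. \<Sum>m\<in>A. W n m * t n * t m) \<le> (\<Sum>n\<in>A. B n * (t n)\<^sup>2)"
proof -
  have amgm: "t n * t m \<le> ((t n)\<^sup>2 * q m / q n + (t m)\<^sup>2 * q n / q m) / 2" for n m
  proof -
    have "0 \<le> (t n * q m - t m * q n)\<^sup>2 / (q n * q m)" using q[of n] q[of m] by simp
    also have "\<dots> = (t n)\<^sup>2 * q m / q n + (t m)\<^sup>2 * q n / q m - 2 * (t n * t m)"
      using q[of n] q[of m] by (simp add: field_simps power2_eq_square)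
    finally show ?thesis by simp
  qed
  have "(\<Sum>n\<in>A. \<Sum>m\<in>A. W n m * t n * t m)
     \<le> (\<Sum>n\<in>A. \<Sum>m\<in>A. (W n m * (t n)\<^sup>2 * q m / q n) / 2 + (W n m * (t m)\<^sup>2 * q n / q m) / 2)"
  proof (intro sum_mono)
    fix n m
    show "W n m * t n * t m \<le> (W n m * (t n)\<^sup>2 * q m / q n) / 2 + (W n m * (t m)\<^sup>2 * q n / q m) / 2"
      using mult_left_mono[OF amgm[of n m] nn[of n m]] by (simp add: algebra_simps add_divide_distrib)
  qed
  also have "\<dots> = (\<Sum>n\<in>A. \<Sum>m\<in>A. (W n m * (t n)\<^sup>2 * q m / q n) / 2)
      + (\<Sum>n\<in>A. \<Sum>m\<in>A. (W n m * (t m)\<^sup>2 * q n / q m) / 2)"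
    by (simp add: sum.distrib)
  also have "(\<Sum>n\<in>A. \<Sum>m\<in>A. (W n m * (t m)\<^sup>2 * q n / q m) / 2)
      = (\<Sum>n\<in>A. \<Sum>m\<in>A. (W n m * (t n)\<^sup>2 * q m / q n) / 2)"
    by (subst sum.swap) (simp add: sym)
  also have "(\<Sum>n\<in>A. \<Sum>m\<in>A. (W n m * (t n)\<^sup>2 * q m / q n) / 2) + (\<Sum>n\<in>A. \<Sum>m\<in>A. (W n m * (t n)\<^sup>2 * q m / q n) / 2)
      = (\<Sum>n\<in>A. (t n)\<^sup>2 / q n * (\<Sum>m\<in>A. W n m * q m))"
    unfolding sum.distrib[symmetric] sum_distrib_left by (intro sum.cong) (auto simp: mult_ac)
  also have "\<dots> \<le> (\<Sum>n\<in>A. (t n)\<^sup>2 / q n * (B n * q n))"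
    using q by (intro sum_mono mult_left_mono bound) (auto simp: less_imp_le)
  also have "\<dots> = (\<Sum>n\<in>A. B n * (t n)\<^sup>2)"
    using less_imp_neq[OF q] by (intro sum.cong) (auto simp: field_simps)
  finally show ?thesis .
qed

section \<open>The explicit positive supersolution\<close>

text \<open>For \<open>l = (2 * lam - 1 + sg) / 4\<close> these are, up to normalisation, the coefficients of
  \<open>(1 + x) * (1 - x\<^sup>2) powr (- (2 * lam + 1 - sg) / 4)\<close>. The even part is the ground state of the
  Hardy inequality (the image of \<open>|\<xi>|\<close> to the power \<open>- (d - sg) / 2\<close> with \<open>d = 2 * lam + 1\<close> under
  stereographic projection); the odd part is only a supersolution.\<close>

definition ground_moment :: "real \<Rightarrow> real \<Rightarrow> nat \<Rightarrow> real" where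
  "ground_moment lam l n = (\<integral>x. gegenbauer lam n x * (1 + x) \<partial>ultra_measure l)"

lemma ground_moment_eq:
  assumes "l > -1/2"
  shows "ground_moment lam l n = integral\<^sup>L (ultra_measure l) (gegenbauer lam n)
           + (\<integral>x. x * gegenbauer lam n x \<partial>ultra_measure l)"
proof -
  have "ground_moment lam l n = (\<integral>x. gegenbauer lam n x + x * gegenbauer lam n x \<partial>ultra_measure l)"
    unfolding ground_moment_def by (simp add: algebra_simps)
  then show ?thesis
    by (simp only:) (intro Bochner_Integration.integral_add integrable_ultra_measure_continuous assms continuous_intros)
qed

lemma ground_moment_even:
  assumes "lam > 0" "l > -1/2"
  shows "ground_moment lam l (2*m) = pochhammer lam m * pochhammer (lam - l) m / fact m
           * (sqrt pi * Gamma (l + 1/2) / Gamma (l + 1 + m))"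
  unfolding ground_moment_eq[OF assms(2)] gegenbauer_moments(1)[OF assms] integral_mult_x_gegenbauer_even by simp

lemma ground_moment_odd:
  assumes "lam > 0" "l > -1/2"
  shows "ground_moment lam l (2*m+1) = pochhammer lam (Suc m) * pochhammer (lam - l) m / fact m
           * (sqrt pi * Gamma (l + 1/2) / Gamma (l + 2 + m))"
  unfolding ground_moment_eq[OF assms(2)] gegenbauer_moments(2)[OF assms] integral_gegenbauer_odd by simp

lemma ground_moment_pos:
  assumes "lam > 0" "l > -1/2" "l < lam"
  shows "ground_moment lam l n > 0"
proof (cases "even n")
  case True
  then obtain m where "n = 2 * m" by auto
  then show ?thesis using assms
    by (auto simp: ground_moment_even intro!: mult_pos_pos divide_pos_pos pochhammer_pos Gamma_real_pos)
next
  case False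
  then obtain m where n: "n = 2 * m + 1" using oddE by blast
  show ?thesis unfolding n ground_moment_odd[OF assms(1,2)]
    using assms by (intro mult_pos_pos divide_pos_pos pochhammer_pos Gamma_real_pos) auto
qed

definition hardy_const :: "real \<Rightarrow> real \<Rightarrow> real" where
  "hardy_const sg lam = 2 powr sg * (Gamma (lam/2 + (1 + sg)/4))\<^sup>2 / (Gamma (lam/2 + (1 - sg)/4))\<^sup>2"

lemma hardy_const_pos:
  assumes "lam > 0" "0 < sg" "sg < 1"
  shows "hardy_const sg lam > 0"
proof -
  have "lam/2 + (1 + sg)/4 > 0" "lam/2 + (1 - sg)/4 > 0"
    using assms by (auto intro!: add_pos_pos)
  then show ?thesis
    unfolding hardy_const_def by (intro divide_pos_pos mult_pos_pos zero_less_power Gamma_real_pos) auto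
qed

text \<open>The orders l1 = (2 lam - 1 - sg)/4 and l2 = (2 lam - 1 + sg)/4 are tied crosswise: lam -
  l1 = l2 + 1/2 = b and lam - l2 = l1 + 1/2 = a. Hence the Pochhammer symbols and the Gamma
  prefactors each contribute one quotient Gamma b / Gamma a, which explains the square in the
  constant. The factors depending on n are then compared with the multiplier.\<close>

lemma hardy_const_ground_moment_le:
  assumes "lam > 0" "0 < sg" "sg < 1"
  shows "hardy_const sg lam * ground_moment lam ((2*lam-1-sg)/4) n \<le> A_mult sg lam n * ground_moment lam ((2*lam-1+sg)/4) n"
proof -
  define a b where "a = (2*lam+1-sg)/4" and "b = (2*lam+1+sg)/4"
  have ab: "0 < a" "0 < b" "a < b" using assms by (auto simp: a_def b_def)
  have G: "Gamma a > 0" "Gamma b > 0" using ab by (auto intro!: Gamma_real_pos)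
  have Q: "hardy_const sg lam = 2 powr sg * (Gamma b)\<^sup>2 / (Gamma a)\<^sup>2"
  proof -
    have "lam/2 + (1 + sg)/4 = b" "lam/2 + (1 - sg)/4 = a" by (auto simp: a_def b_def field_simps)
    then show ?thesis by (simp add: hardy_const_def)
  qed
  have l: "(2*lam-1-sg)/4 > -1/2" "(2*lam-1+sg)/4 > -1/2" using assms by auto
  have lb: "lam - (2*lam-1-sg)/4 = b" "lam - (2*lam-1+sg)/4 = a"
    "(2*lam-1-sg)/4 + 1/2 = a" "(2*lam-1+sg)/4 + 1/2 = b" by (auto simp: a_def b_def field_simps)
  show ?thesis
  proof (cases "even n")
    case True
    then obtain m where n: "n = 2 * m" by auto
    define z w where "z = a + real m" and "w = b + real m"
    have d: "2 * w - 2 * z = sg" by (simp add: z_def w_def a_def b_def field_simps)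
    have zw: "0 < z" "0 < w" using ab by (auto simp: z_def w_def)
    have Gz: "Gamma z > 0" "Gamma w > 0" "Gamma (z + 1/2) > 0" "Gamma (w + 1/2) > 0"
      using zw by (auto intro!: Gamma_real_pos)
    have e: "(2*lam-1-sg)/4 + 1 + real m = z + 1/2" "(2*lam-1+sg)/4 + 1 + real m = w + 1/2"
      by (auto simp: z_def w_def a_def b_def field_simps)
    have P: "pochhammer a m = Gamma z / Gamma a" "pochhammer b m = Gamma w / Gamma b"
      unfolding z_def w_def using ab by (auto intro!: pochhammer_Gamma elim!: nonpos_Ints_cases)
    have "A_mult sg lam n = Gamma (2*w) / Gamma (2*z)"
    proof -
      have "real n + lam + (1 + sg)/2 = 2*w" "real n + lam + (1 - sg)/2 = 2*z"
        by (auto simp: n z_def w_def a_def b_def field_simps)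
      then show ?thesis by (simp add: A_mult_def)
    qed
    also have "\<dots> = 2 powr sg * (Gamma w * Gamma (w + 1/2)) / (Gamma z * Gamma (z + 1/2))"
      unfolding Gamma_double_ratio[OF zw(2,1)] d by simp
    finally have A: "A_mult sg lam n = 2 powr sg * (Gamma w * Gamma (w + 1/2)) / (Gamma z * Gamma (z + 1/2))" .
    show ?thesis
      unfolding A[unfolded n] n ground_moment_even[OF assms(1) l(1)] ground_moment_even[OF assms(1) l(2)] lb e Q P
      using G Gz by (simp add: power2_eq_square mult_ac)
  next
    case False
    then obtain m where n: "n = 2 * m + 1" using oddE by blast
    define z w where "z = a + real m" and "w = b + real m"
    define c where "c = pochhammer lam (Suc m) / fact m * sqrt pi"
    have c: "c > 0" unfolding c_def using assms(1) by (intro mult_pos_pos divide_pos_pos pochhammer_pos) auto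
    \<comment> \<open>For odd n the doubled arguments are w + 1/2 and z + 1/2. Duplication therefore
      produces w Gamma w and z Gamma z, while the moments contain (w + 1/2) Gamma (w + 1/2) and its
      analogue in z; the two do not cancel completely.\<close>
    have d: "2 * (w + 1/2) - 2 * (z + 1/2) = sg" by (simp add: z_def w_def a_def b_def field_simps)
    have zw: "0 < z" "0 < w" "z \<le> w" using ab by (auto simp: z_def w_def)
    have Gz: "Gamma z > 0" "Gamma w > 0" "Gamma (z + 1/2) > 0" "Gamma (w + 1/2) > 0"
      using zw by (auto intro!: Gamma_real_pos)
    have e: "(2*lam-1-sg)/4 + 2 + real m = z + 1/2 + 1" "(2*lam-1+sg)/4 + 2 + real m = w + 1/2 + 1"
      by (auto simp: z_def w_def a_def b_def field_simps)
    have r: "Gamma (z + 1/2 + 1) = (z + 1/2) * Gamma (z + 1/2)" "Gamma (w + 1/2 + 1) = (w + 1/2) * Gamma (w + 1/2)"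
      "Gamma (z + 1/2 + 1/2) = z * Gamma z" "Gamma (w + 1/2 + 1/2) = w * Gamma w"
      using zw Gamma_plus1_pos[of "z + 1/2"] Gamma_plus1_pos[of "w + 1/2"] Gamma_plus1_pos[of z] Gamma_plus1_pos[of w]
      by (auto simp: add.commute)
    have P: "pochhammer a m = Gamma z / Gamma a" "pochhammer b m = Gamma w / Gamma b"
      unfolding z_def w_def using ab by (auto intro!: pochhammer_Gamma elim!: nonpos_Ints_cases)
    have zw2: "w + 1/2 > 0" "z + 1/2 > 0" using zw by auto
    have "A_mult sg lam n = Gamma (2*(w + 1/2)) / Gamma (2*(z + 1/2))"
    proof -
      have "real n + lam + (1 + sg)/2 = 2*(w + 1/2)" "real n + lam + (1 - sg)/2 = 2*(z + 1/2)"
        by (auto simp: n z_def w_def a_def b_def field_simps)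
      then show ?thesis by (simp add: A_mult_def)
    qed
    also have "\<dots> = 2 powr sg * (Gamma (w + 1/2) * (w * Gamma w)) / (Gamma (z + 1/2) * (z * Gamma z))"
      unfolding Gamma_double_ratio[OF zw2] r d by simp
    finally have A: "A_mult sg lam n = 2 powr sg * (Gamma (w + 1/2) * (w * Gamma w)) / (Gamma (z + 1/2) * (z * Gamma z))" .
    define K where "K = 2 powr sg * c * Gamma b / Gamma a * Gamma w / Gamma (z + 1/2)"
    have K: "K > 0" unfolding K_def using c G Gz by (intro mult_pos_pos divide_pos_pos) auto
    have "hardy_const sg lam * ground_moment lam ((2*lam-1-sg)/4) n = K / (z + 1/2)"
      unfolding n ground_moment_odd[OF assms(1) l(1)] lb e Q P r K_def c_def
      using G Gz zw2 by (simp add: power2_eq_square mult_ac)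
    also have "\<dots> \<le> K * (w / (z * (w + 1/2)))"
    proof -
      \<comment> \<open>Equivalent to z / (z + 1/2) \<le> w / (w + 1/2), the monotonicity that
        remains after cancelling K.\<close>
      have "1 / (z + 1/2) \<le> w / (z * (w + 1/2))"
        using zw by (simp add: divide_simps) (simp add: algebra_simps)
      from mult_left_mono[OF this less_imp_le[OF K]] show ?thesis by simp
    qed
    also have "\<dots> = A_mult sg lam n * ground_moment lam ((2*lam-1+sg)/4) n"
      unfolding A[unfolded n] n ground_moment_odd[OF assms(1) l(2)] lb e Q P r K_def c_def
      using G[THEN less_imp_neq] Gz[THEN less_imp_neq] zw zw2 by (simp add: power2_eq_square mult_ac)
    finally show ?thesis .
  qed
qed

section \<open>The matrix of the Hardy weight\<close>

text \<open>Entries of W for s = sg/2, taken with the unnormalised C_n. This is why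
  \<open>gegenbauer_inner lam m m\<close> divides wherever a coefficient is meant.\<close>

definition weighted_inner :: "real \<Rightarrow> real \<Rightarrow> nat \<Rightarrow> nat \<Rightarrow> real" where
  "weighted_inner lam s n m = (\<integral>x. gegenbauer lam n x * gegenbauer lam m x \<partial>ultra_measure (lam - s))"

lemma weighted_inner_commute: "weighted_inner lam s n m = weighted_inner lam s m n"
  by (simp add: weighted_inner_def mult.commute)

lemma weighted_inner_limit:
  assumes "lam > 0" "s > 0" "lam - s > -1/2"
  shows "(\<lambda>K. \<integral>x. (binomial_partial s K x * gegenbauer lam n x) * gegenbauer lam m x \<partial>ultra_measure lam)
           \<longlonglongrightarrow> weighted_inner lam s n m"
  unfolding weighted_inner_def mult.assoc
  by (intro integral_binomial_partial_tendsto assms continuous_intros)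

text \<open>Each approximating integral is, up to the positive squared norm, a coefficient of an
  element of the cone.\<close>

lemma weighted_inner_nonneg:
  assumes "lam > 0" "s > 0" "lam - s > -1/2"
  shows "weighted_inner lam s n m \<ge> 0"
  by (rule LIMSEQ_le_const[OF weighted_inner_limit[OF assms]])
     (auto intro!: integral_cone_nonneg binomial_partial_mult_in_cone gegenbauer_in_cone assms)

text \<open>This is the bound on a truncated row of W p. For each K it is the pairing inequality
  with g = 1 + x; then K tends to infinity with N fixed, so the left side stays a finite sum and
  converges term by term.\<close>

lemma weighted_inner_ground_moment_le:
  assumes "lam > 0" "s > 0" "lam - s > -1/2" "l - s > -1/2" "l < lam"
  shows "(\<Sum>m\<le>N. weighted_inner lam s n m / gegenbauer_inner lam m m * ground_moment lam l m)
          \<le> ground_moment lam (l - s) n"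
proof (rule LIMSEQ_le)
  show "(\<lambda>K. \<Sum>m\<le>N. (\<integral>x. (binomial_partial s K x * gegenbauer lam n x) * gegenbauer lam m x \<partial>ultra_measure lam)
          / gegenbauer_inner lam m m * ground_moment lam l m)
      \<longlonglongrightarrow> (\<Sum>m\<le>N. weighted_inner lam s n m / gegenbauer_inner lam m m * ground_moment lam l m)"
    unfolding divide_inverse by (intro tendsto_intros weighted_inner_limit assms)
  show "(\<lambda>K. \<integral>x. (binomial_partial s K x * gegenbauer lam n x) * (1 + x) \<partial>ultra_measure l)
      \<longlonglongrightarrow> ground_moment lam (l - s) n"
    unfolding ground_moment_def mult.assoc
    by (intro integral_binomial_partial_tendsto assms continuous_intros)
  have l: "l > -1/2" using assms by simp
  have c: "continuous_on UNIV (\<lambda>x::real. 1 + x)" by (intro continuous_intros)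
  show "\<exists>M. \<forall>K\<ge>M. (\<Sum>m\<le>N. (\<integral>x. (binomial_partial s K x * gegenbauer lam n x) * gegenbauer lam m x \<partial>ultra_measure lam)
          / gegenbauer_inner lam m m * ground_moment lam l m)
      \<le> (\<integral>x. (binomial_partial s K x * gegenbauer lam n x) * (1 + x) \<partial>ultra_measure l)"
    using cone_coefficients_pairing_le[OF assms(1) binomial_partial_mult_in_cone[OF assms(1,2) gegenbauer_in_cone] c l]
      less_imp_le[OF ground_moment_pos[OF assms(1) l assms(5)]]
    by (auto simp: ground_moment_def)
qed

lemma hardy_polynomial:
  assumes "lam > 0" "0 < sg" "sg < 1"
  shows "hardy_const sg lam * (\<integral>x. (\<Sum>n\<le>N. t n * gegenbauer lam n x)\<^sup>2 \<partial>ultra_measure (lam - sg/2))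
         \<le> (\<Sum>n\<le>N. A_mult sg lam n * gegenbauer_inner lam n n * (t n)\<^sup>2)"
proof -
  define l where "l = (2*lam-1+sg)/4"
  define Q where "Q = hardy_const sg lam"
  have Q: "Q > 0" unfolding Q_def by (rule hardy_const_pos[OF assms])
  have l: "l < lam" "l > -1/2" "l - sg/2 > -1/2" "lam - sg/2 > -1/2" "l - sg/2 = (2*lam-1-sg)/4" "sg/2 > 0"
    using assms by (auto simp: l_def field_simps)
  have h: "gegenbauer_inner lam n n > 0" for n by (rule gegenbauer_inner_self_pos[OF assms(1)])
  have "(\<integral>x. (\<Sum>n\<le>N. t n * gegenbauer lam n x)\<^sup>2 \<partial>ultra_measure (lam - sg/2))
     = (\<integral>x. (\<Sum>n\<le>N. \<Sum>m\<le>N. t n * t m * (gegenbauer lam n x * gegenbauer lam m x)) \<partial>ultra_measure (lam - sg/2))"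
    unfolding power2_eq_square sum_product by (simp only: mult_ac)
  also have "\<dots> = (\<Sum>n\<le>N. \<Sum>m\<le>N. \<integral>x. t n * t m * (gegenbauer lam n x * gegenbauer lam m x) \<partial>ultra_measure (lam - sg/2))"
    by (subst Bochner_Integration.integral_sum
        | intro sum.cong refl Bochner_Integration.integral_sum integrable_ultra_measure_continuous l continuous_intros)+
  also have "\<dots> = (\<Sum>n\<le>N. \<Sum>m\<le>N. weighted_inner lam (sg/2) n m * t n * t m)"
    by (intro sum.cong refl) (simp add: weighted_inner_def)
  also have "\<dots> \<le> (\<Sum>n\<le>N. (A_mult sg lam n * gegenbauer_inner lam n n / Q) * (t n)\<^sup>2)"
  \<comment> \<open>The test vector holds the coefficients of the ground function with respect to
    C_n: moment divided by squared norm.\<close>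
  proof (rule schur_test_finite[where q = "\<lambda>n. ground_moment lam l n / gegenbauer_inner lam n n"])
    show "weighted_inner lam (sg/2) n m = weighted_inner lam (sg/2) m n" for n m
      by (rule weighted_inner_commute)
    show "weighted_inner lam (sg/2) n m \<ge> 0" for n m
      by (rule weighted_inner_nonneg[OF assms(1) l(6,4)])
    show "ground_moment lam l n / gegenbauer_inner lam n n > 0" for n
      by (intro divide_pos_pos ground_moment_pos h assms l)
    show "(\<Sum>m\<le>N. weighted_inner lam (sg/2) n m * (ground_moment lam l m / gegenbauer_inner lam m m))
       \<le> A_mult sg lam n * gegenbauer_inner lam n n / Q * (ground_moment lam l n / gegenbauer_inner lam n n)" for n
    proof -
      have "(\<Sum>m\<le>N. weighted_inner lam (sg/2) n m * (ground_moment lam l m / gegenbauer_inner lam m m))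
         \<le> ground_moment lam (l - sg/2) n"
        using weighted_inner_ground_moment_le[OF assms(1) l(6,4,3,1), of n N] by simp
      also have "\<dots> \<le> A_mult sg lam n * ground_moment lam l n / Q"
        using hardy_const_ground_moment_le[OF assms, of n, folded Q_def l(5), folded l_def] Q
        by (simp add: pos_le_divide_eq mult.commute)
      also have "\<dots> = A_mult sg lam n * gegenbauer_inner lam n n / Q * (ground_moment lam l n / gegenbauer_inner lam n n)"
        using less_imp_neq[OF h[of n]] by simp
      finally show ?thesis .
    qed
  qed
  also have "\<dots> = (\<Sum>n\<le>N. A_mult sg lam n * gegenbauer_inner lam n n * (t n)\<^sup>2) / Q"
    by (simp add: sum_divide_distrib)
  finally show ?thesis using Q by (simp add: Q_def[symmetric] pos_le_divide_eq mult.commute)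
qed

section \<open>Completeness in \<open>L\<^sup>2\<close>\<close>

lemma AE_ultra_measure_lebesgue:
  assumes "AE x in lebesgue. P x"
  shows "AE x in ultra_measure l. P x"
proof -
  have "AE x in lborel. P x" using assms by (simp add: AE_completion_iff)
  then show ?thesis unfolding ultra_measure_def by (subst AE_density) (auto elim: eventually_mono)
qed

text \<open>One sequence works for all orders: the exceptional set is Lebesgue null, and every
  \<open>ultra_measure l\<close> has a density with respect to Lebesgue measure.\<close>

lemma borel_limit_of_continuous:
  fixes u :: "real \<Rightarrow> real"
  assumes "u \<in> borel_measurable borel"
  obtains g where "\<And>j. continuous_on UNIV (g j)" "\<And>l. AE x in ultra_measure l. (\<lambda>j. g j x) \<longlonglongrightarrow> u x"
proof -
  have "u \<in> borel_measurable lebesgue" using assms by (simp add: measurable_completion)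
  then have "u measurable_on UNIV" by (intro lebesgue_measurable_imp_measurable_on_real) auto
  then obtain N g where N: "negligible N" and g: "\<And>j. continuous_on UNIV (g j)"
    and lim: "\<And>x. x \<notin> N \<Longrightarrow> (\<lambda>j. g j x) \<longlonglongrightarrow> u x"
    unfolding measurable_on_def by auto
  have "AE x in lebesgue. x \<notin> N" using N by (simp add: negligible_iff_null_sets AE_not_in)
  then have "AE x in ultra_measure l. (\<lambda>j. g j x) \<longlonglongrightarrow> u x" for l
    by (intro AE_ultra_measure_lebesgue) (auto elim!: eventually_mono intro: lim)
  then show ?thesis using that g by blast
qed

text \<open>Truncation to [-k, k]. Being continuous, it can be applied to the continuous
  approximants as well, which gives them a common bound without losing continuity or pointwise
  convergence.\<close>

definition clip :: "real \<Rightarrow> real \<Rightarrow> real" where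
  "clip k y = max (- k) (min k y)"

lemma clip_bound: "k \<ge> 0 \<Longrightarrow> \<bar>clip k y\<bar> \<le> k"
  by (auto simp: clip_def)

lemma clip_id: "\<bar>y\<bar> \<le> k \<Longrightarrow> clip k y = y"
  by (auto simp: clip_def)

lemma clip_diff_le: "k \<ge> 0 \<Longrightarrow> \<bar>y - clip k y\<bar> \<le> \<bar>y\<bar>"
  by (auto simp: clip_def)

lemma continuous_on_clip [continuous_intros]: "continuous_on S f \<Longrightarrow> continuous_on S (\<lambda>x. clip k (f x))"
  unfolding clip_def by (intro continuous_intros)

lemma measurable_clip [measurable]: "clip k \<in> borel_measurable borel"
  by (intro borel_measurable_continuous_onI continuous_intros)

lemma L2_approx_bounded:
  assumes [measurable]: "u \<in> borel_measurable borel" and u2: "integrable (ultra_measure l) (\<lambda>x. (u x)\<^sup>2)"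
  shows "(\<lambda>k. \<integral>x. (u x - clip (real k) (u x))\<^sup>2 \<partial>ultra_measure l) \<longlonglongrightarrow> 0"
proof -
  have "(\<lambda>k. \<integral>x. (u x - clip (real k) (u x))\<^sup>2 \<partial>ultra_measure l) \<longlonglongrightarrow> (\<integral>x. 0 \<partial>ultra_measure l)"
  proof (rule integral_dominated_convergence[OF _ _ u2])
    show "AE x in ultra_measure l. (\<lambda>k. (u x - clip (real k) (u x))\<^sup>2) \<longlonglongrightarrow> 0"
    proof (intro AE_I2 tendsto_eventually)
      fix x
      show "\<forall>\<^sub>F k in sequentially. (u x - clip (real k) (u x))\<^sup>2 = 0"
        using eventually_ge_at_top[of "nat \<lceil>\<bar>u x\<bar>\<rceil>"]
        by eventually_elim (simp add: clip_id nat_le_iff ceiling_le_iff)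
    qed
    show "AE x in ultra_measure l. norm ((u x - clip (real k) (u x))\<^sup>2) \<le> (u x)\<^sup>2" for k
      using clip_diff_le[of "real k"] by (simp add: abs_le_square_iff)
  qed measurable
  then show ?thesis by simp
qed

text \<open>The approximants are clipped continuous functions converging almost everywhere; the
  constant (2 k)^2 dominates because the measure is finite.\<close>

lemma L2_approx_continuous:
  assumes "l > -1/2" and [measurable]: "u \<in> borel_measurable borel" and "k \<ge> 0" "e > 0"
  obtains g where "continuous_on UNIV g" "(\<integral>x. (clip k (u x) - g x)\<^sup>2 \<partial>ultra_measure l) < e"
proof -
  interpret finite_measure "ultra_measure l" by (rule finite_measure_ultra_measure[OF assms(1)])
  obtain g where g: "\<And>j. continuous_on UNIV (g j)" and lim: "AE x in ultra_measure l. (\<lambda>j. g j x) \<longlonglongrightarrow> u x"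
    using borel_limit_of_continuous[OF assms(2)] by metis
  have [measurable]: "g j \<in> borel_measurable borel" for j using g by (rule borel_measurable_continuous_onI)
  have "(\<lambda>j. \<integral>x. (clip k (u x) - clip k (g j x))\<^sup>2 \<partial>ultra_measure l) \<longlonglongrightarrow> (\<integral>x. 0 \<partial>ultra_measure l)"
  proof (rule integral_dominated_convergence[where w = "\<lambda>_. (2 * k)\<^sup>2"])
    show "AE x in ultra_measure l. (\<lambda>j. (clip k (u x) - clip k (g j x))\<^sup>2) \<longlonglongrightarrow> 0"
      using lim
    proof eventually_elim
      case (elim x)
      then have "(\<lambda>j. (clip k (u x) - clip k (g j x))\<^sup>2) \<longlonglongrightarrow> (clip k (u x) - clip k (u x))\<^sup>2"
        unfolding clip_def by (intro tendsto_intros)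
      then show ?case by simp
    qed
    show "AE x in ultra_measure l. norm ((clip k (u x) - clip k (g j x))\<^sup>2) \<le> (2 * k)\<^sup>2" for j
    proof (intro AE_I2)
      fix x
      have "\<bar>clip k (u x) - clip k (g j x)\<bar> \<le> \<bar>2 * k\<bar>"
        using clip_bound[OF assms(3), of "u x"] clip_bound[OF assms(3), of "g j x"] by linarith
      then show "norm ((clip k (u x) - clip k (g j x))\<^sup>2) \<le> (2 * k)\<^sup>2"
        by (simp only: abs_le_square_iff) simp
    qed
  qed auto
  then have "\<forall>\<^sub>F j in sequentially. (\<integral>x. (clip k (u x) - clip k (g j x))\<^sup>2 \<partial>ultra_measure l) < e"
    using order_tendstoD(2)[of _ 0] \<open>e > 0\<close> by simp
  then obtain j where "(\<integral>x. (clip k (u x) - clip k (g j x))\<^sup>2 \<partial>ultra_measure l) < e"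
    using eventually_happens'[OF sequentially_bot] by blast
  then show ?thesis using that[of "\<lambda>x. clip k (g j x)"] g
    by (auto intro!: continuous_intros)
qed

lemma L2_approx_polynomial:
  assumes "l > -1/2" and g: "continuous_on UNIV g" and "e > 0"
  obtains p where "real_polynomial_function p" "(\<integral>x. (g x - p x)\<^sup>2 \<partial>ultra_measure l) < e"
proof -
  interpret finite_measure "ultra_measure l" by (rule finite_measure_ultra_measure[OF assms(1)])
  define M where "M = measure (ultra_measure l) UNIV"
  have M: "M \<ge> 0" by (simp add: M_def)
  \<comment> \<open>A uniform error d costs M d^2 = M e / (M + 1) < e; the added 1 keeps the divisor
    positive and the estimate strict.\<close>
  define d where "d = sqrt (e / (M + 1))"
  have d: "d > 0" "d\<^sup>2 = e / (M + 1)" using assms M by (auto simp: d_def)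
  obtain p where p: "real_polynomial_function p" and le: "\<And>x. x \<in> {-1..1} \<Longrightarrow> \<bar>g x - p x\<bar> < d"
    using Stone_Weierstrass_real_polynomial_function[of "{-1..1::real}" g d] g d
    by (auto intro: continuous_on_subset)
  have pc: "continuous_on UNIV p"
    using continuous_real_polymonial_function[OF p] continuous_at_imp_continuous_on by blast
  have "(\<integral>x. (g x - p x)\<^sup>2 \<partial>ultra_measure l) \<le> (\<integral>x. d\<^sup>2 \<partial>ultra_measure l)"
  proof (rule integral_mono_AE)
    show "integrable (ultra_measure l) (\<lambda>x. (g x - p x)\<^sup>2)"
      by (intro integrable_ultra_measure_continuous assms continuous_intros pc)
    show "AE x in ultra_measure l. (g x - p x)\<^sup>2 \<le> d\<^sup>2"
      using AE_ultra_measure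
    proof eventually_elim
      case (elim x)
      then have "\<bar>g x - p x\<bar> \<le> \<bar>d\<bar>" using le[of x] d by auto
      then show ?case by (simp only: abs_le_square_iff)
    qed
  qed simp
  also have "\<dots> = M * (e / (M + 1))" by (simp add: M_def d(2))
  also have "\<dots> < e" using M \<open>e > 0\<close> by (simp add: divide_simps)
  finally show ?thesis using that p by blast
qed

lemma monomial_gegenbauer_expansion:
  assumes "lam > 0"
  shows "\<exists>y N. \<forall>x. x ^ k = (\<Sum>m\<le>N. y m * gegenbauer lam m x)"
  using cone_expansion[OF gegenbauer_cone_mult_power[OF assms gegenbauer_in_cone[of lam 0], of k]] assms
  by (auto simp: fun_eq_iff)

lemma gegenbauer_expansion_extend:
  assumes "N \<le> M"
  shows "(\<Sum>m\<le>N. y m * gegenbauer lam m x) = (\<Sum>m\<le>M. (if m \<le> N then y m else 0) * gegenbauer lam m x)"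
  using assms by (intro sum.mono_neutral_cong_left) auto

lemma polynomial_gegenbauer_expansion:
  assumes "lam > 0" "real_polynomial_function p"
  shows "\<exists>y N. \<forall>x. p x = (\<Sum>m\<le>N. y m * gegenbauer lam m x)"
proof -
  obtain a K where p: "p = (\<lambda>x. \<Sum>i\<le>K. a i * x ^ i)"
    using assms(2) real_polynomial_function_iff_sum by blast
  obtain y n where y: "\<And>k x. x ^ k = (\<Sum>m\<le>n k. y k m * gegenbauer lam m x)"
    using monomial_gegenbauer_expansion[OF assms(1)] by metis
  define N where "N = Max (n ` {..K})"
  define z where "z i m = (if m \<le> n i then y i m else 0)" for i m
  have "p x = (\<Sum>m\<le>N. (\<Sum>i\<le>K. a i * z i m) * gegenbauer lam m x)" for x
  proof -
    have "p x = (\<Sum>i\<le>K. a i * (\<Sum>m\<le>N. z i m * gegenbauer lam m x))"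
      unfolding p z_def
      by (intro sum.cong refl arg_cong2[where f = "(*)"])
         (subst y, rule gegenbauer_expansion_extend, auto simp: N_def)
    also have "\<dots> = (\<Sum>m\<le>N. \<Sum>i\<le>K. a i * z i m * gegenbauer lam m x)"
      unfolding sum_distrib_left by (subst sum.swap) (simp add: mult.assoc)
    finally show ?thesis by (simp add: sum_distrib_right)
  qed
  then show ?thesis by (intro exI[of _ "\<lambda>m. \<Sum>i\<le>K. a i * z i m"] exI[of _ N]) blast
qed

lemma integrable_mult_of_squares:
  fixes f g :: "'a \<Rightarrow> real"
  assumes [measurable]: "f \<in> borel_measurable M" "g \<in> borel_measurable M"
    and "integrable M (\<lambda>x. (f x)\<^sup>2)" "integrable M (\<lambda>x. (g x)\<^sup>2)"
  shows "integrable M (\<lambda>x. f x * g x)"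
proof (rule Bochner_Integration.integrable_bound[of M "\<lambda>x. (f x)\<^sup>2 + (g x)\<^sup>2"])
  show "AE x in M. norm (f x * g x) \<le> norm ((f x)\<^sup>2 + (g x)\<^sup>2)"
  proof (intro AE_I2)
    fix x
    have "0 \<le> (\<bar>f x\<bar> - \<bar>g x\<bar>)\<^sup>2" by simp
    then have "2 * (\<bar>f x\<bar> * \<bar>g x\<bar>) \<le> (f x)\<^sup>2 + (g x)\<^sup>2"
      by (simp add: power2_diff)
    moreover have "0 \<le> \<bar>f x\<bar> * \<bar>g x\<bar>" by simp
    ultimately show "norm (f x * g x) \<le> norm ((f x)\<^sup>2 + (g x)\<^sup>2)"
      unfolding real_norm_def abs_mult by linarith
  qed
qed (use assms in auto)

lemma integrable_square_diff:
  fixes f g :: "'a \<Rightarrow> real"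
  assumes "f \<in> borel_measurable M" "g \<in> borel_measurable M"
    and "integrable M (\<lambda>x. (f x)\<^sup>2)" "integrable M (\<lambda>x. (g x)\<^sup>2)"
  shows "integrable M (\<lambda>x. (f x - g x)\<^sup>2)"
  unfolding power2_diff
  using assms integrable_mult_of_squares[OF assms]
  by (intro Bochner_Integration.integrable_diff Bochner_Integration.integrable_add) (auto simp: mult.assoc)

lemma gegenbauer_dense:
  assumes "lam > 0" and [measurable]: "u \<in> borel_measurable borel"
    and u2: "integrable (ultra_measure lam) (\<lambda>x. (u x)\<^sup>2)" and "e > 0"
  shows "\<exists>y N. (\<integral>x. (u x - (\<Sum>m\<le>N. y m * gegenbauer lam m x))\<^sup>2 \<partial>ultra_measure lam) < e"
proof -
  let ?M = "ultra_measure lam"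
  have l: "lam > -1/2" using assms by simp
  interpret finite_measure ?M by (rule finite_measure_ultra_measure[OF l])
  \<comment> \<open>Three errors of size e/9 combine through (a + b + c)^2 \<le> 3 (a^2 + b^2 + c^2)
    to less than e.\<close>
  have "\<forall>\<^sub>F k in sequentially. (\<integral>x. (u x - clip (real k) (u x))\<^sup>2 \<partial>?M) < e / 9"
    using order_tendstoD(2)[OF L2_approx_bounded[OF assms(2) u2], of "e / 9"] \<open>e > 0\<close> by simp
  then obtain k :: nat where k: "(\<integral>x. (u x - clip (real k) (u x))\<^sup>2 \<partial>?M) < e / 9"
    using eventually_happens'[OF sequentially_bot] by blast
  define v where "v x = clip (real k) (u x)" for x
  have [measurable]: "v \<in> borel_measurable borel" unfolding v_def by measurable
  have v2: "integrable ?M (\<lambda>x. (v x)\<^sup>2)"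
  proof (rule integrable_const_bound[where B = "(real k)\<^sup>2"])
    show "AE x in ?M. norm ((v x)\<^sup>2) \<le> (real k)\<^sup>2"
      using clip_bound[of "real k"] by (auto simp: v_def abs_le_square_iff[symmetric])
  qed measurable
  obtain g where g: "continuous_on UNIV g" and vg: "(\<integral>x. (v x - g x)\<^sup>2 \<partial>?M) < e / 9"
    using L2_approx_continuous[OF l assms(2), of "real k" "e / 9"] \<open>e > 0\<close> unfolding v_def by auto
  obtain p where p: "real_polynomial_function p" and gp: "(\<integral>x. (g x - p x)\<^sup>2 \<partial>?M) < e / 9"
    using L2_approx_polynomial[OF l g, of "e / 9"] \<open>e > 0\<close> by auto
  have pc: "continuous_on UNIV p"
    using continuous_real_polymonial_function[OF p] continuous_at_imp_continuous_on by blast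
  have [measurable]: "g \<in> borel_measurable borel" "p \<in> borel_measurable borel"
    using g pc by (auto intro: borel_measurable_continuous_onI)
  have I: "integrable ?M (\<lambda>x. (g x)\<^sup>2)" "integrable ?M (\<lambda>x. (g x - p x)\<^sup>2)" "integrable ?M (\<lambda>x. (p x)\<^sup>2)"
    by (intro integrable_ultra_measure_continuous l continuous_intros g pc)+
  have J: "integrable ?M (\<lambda>x. (u x - v x)\<^sup>2)" "integrable ?M (\<lambda>x. (v x - g x)\<^sup>2)" "integrable ?M (\<lambda>x. (u x - p x)\<^sup>2)"
    by (auto intro!: integrable_square_diff u2 v2 I)
  have "(\<integral>x. (u x - p x)\<^sup>2 \<partial>?M) \<le> (\<integral>x. 3 * ((u x - v x)\<^sup>2 + (v x - g x)\<^sup>2 + (g x - p x)\<^sup>2) \<partial>?M)"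
  proof (rule integral_mono)
    fix x
    have *: "(a + b + c)\<^sup>2 \<le> 3 * (a\<^sup>2 + b\<^sup>2 + c\<^sup>2)" for a b c :: real
      using zero_le_power2[of "a - b"] zero_le_power2[of "b - c"] zero_le_power2[of "a - c"]
      by (simp add: power2_eq_square algebra_simps)
    show "(u x - p x)\<^sup>2 \<le> 3 * ((u x - v x)\<^sup>2 + (v x - g x)\<^sup>2 + (g x - p x)\<^sup>2)"
      using *[of "u x - v x" "v x - g x" "g x - p x"] by simp
  qed (use J I in auto)
  also have "\<dots> = 3 * ((\<integral>x. (u x - v x)\<^sup>2 \<partial>?M) + (\<integral>x. (v x - g x)\<^sup>2 \<partial>?M) + (\<integral>x. (g x - p x)\<^sup>2 \<partial>?M))"
    using J I by simp
  also have "\<dots> < e" using k vg gp by (simp add: v_def)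
  finally have lt: "(\<integral>x. (u x - p x)\<^sup>2 \<partial>?M) < e" .
  obtain y N where "\<And>x. p x = (\<Sum>m\<le>N. y m * gegenbauer lam m x)"
    using polynomial_gegenbauer_expansion[OF assms(1) p] by blast
  with lt show ?thesis by auto
qed

section \<open>Convergence of the Gegenbauer expansion\<close>

text \<open>For u in L^2 this is its orthogonal projection onto the span of C_0, ..., C_N.\<close>

definition gegenbauer_partial :: "real \<Rightarrow> (real \<Rightarrow> real) \<Rightarrow> nat \<Rightarrow> real \<Rightarrow> real" where
  "gegenbauer_partial lam u N x = (\<Sum>n\<le>N. (\<integral>z. u z * gegenbauer lam n z \<partial>ultra_measure lam)
      / gegenbauer_inner lam n n * gegenbauer lam n x)"

lemma continuous_on_gegenbauer_partial: "continuous_on UNIV (gegenbauer_partial lam u N)"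
  unfolding gegenbauer_partial_def by (intro continuous_intros)

context
  fixes lam :: real and u :: "real \<Rightarrow> real"
  assumes lam: "lam > 0" and u [measurable]: "u \<in> borel_measurable borel"
    and u2: "integrable (ultra_measure lam) (\<lambda>x. (u x)\<^sup>2)"
begin

lemma integrable_L2_mult_continuous:
  assumes g: "continuous_on UNIV g"
  shows "integrable (ultra_measure lam) (\<lambda>x. u x * g x)"
proof (rule integrable_mult_of_squares[OF _ _ u2])
  show "g \<in> borel_measurable (ultra_measure lam)"
    using borel_measurable_continuous_onI[OF g] by simp
  show "integrable (ultra_measure lam) (\<lambda>x. (g x)\<^sup>2)"
    using lam by (intro integrable_ultra_measure_continuous continuous_intros g) auto
qed simp

lemma gegenbauer_partial_residual_orthogonal:
  assumes "n \<le> N"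
  shows "(\<integral>x. (u x - gegenbauer_partial lam u N x) * gegenbauer lam n x \<partial>ultra_measure lam) = 0"
proof -
  let ?M = "ultra_measure lam"
  have l: "lam > -1/2" using lam by simp
  define t where "t m = (\<integral>z. u z * gegenbauer lam m z \<partial>?M) / gegenbauer_inner lam m m" for m
  have "(\<integral>x. gegenbauer_partial lam u N x * gegenbauer lam n x \<partial>?M)
      = (\<integral>x. (\<Sum>m\<le>N. t m * (gegenbauer lam m x * gegenbauer lam n x)) \<partial>?M)"
    unfolding gegenbauer_partial_def t_def by (simp add: sum_distrib_right mult.assoc)
  also have "\<dots> = (\<Sum>m\<le>N. \<integral>x. t m * (gegenbauer lam m x * gegenbauer lam n x) \<partial>?M)"
    by (intro Bochner_Integration.integral_sum integrable_ultra_measure_continuous l continuous_intros)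
  also have "\<dots> = (\<Sum>m\<le>N. if m = n then t n * gegenbauer_inner lam n n else 0)"
    using gegenbauer_orthogonal[OF lam]
    by (intro sum.cong refl) (auto simp: gegenbauer_inner_def[symmetric])
  also have "\<dots> = (\<integral>x. u x * gegenbauer lam n x \<partial>?M)"
    using assms less_imp_neq[OF gegenbauer_inner_self_pos[OF lam, of n]] by (simp add: t_def)
  finally have eq: "(\<integral>x. gegenbauer_partial lam u N x * gegenbauer lam n x \<partial>?M) = (\<integral>x. u x * gegenbauer lam n x \<partial>?M)" .
  have "(\<integral>x. (u x - gegenbauer_partial lam u N x) * gegenbauer lam n x \<partial>?M)
     = (\<integral>x. u x * gegenbauer lam n x - gegenbauer_partial lam u N x * gegenbauer lam n x \<partial>?M)"
    by (simp only: left_diff_distrib)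
  also have "\<dots> = (\<integral>x. u x * gegenbauer lam n x \<partial>?M) - (\<integral>x. gegenbauer_partial lam u N x * gegenbauer lam n x \<partial>?M)"
    by (intro Bochner_Integration.integral_diff integrable_L2_mult_continuous integrable_ultra_measure_continuous l
        continuous_intros continuous_on_gegenbauer_partial)
  finally show ?thesis using eq by simp
qed

lemma integrable_residual_square:
  assumes g: "continuous_on UNIV g"
  shows "integrable (ultra_measure lam) (\<lambda>x. (u x - g x)\<^sup>2)"
proof (rule integrable_square_diff[OF _ _ u2])
  show "g \<in> borel_measurable (ultra_measure lam)"
    using borel_measurable_continuous_onI[OF g] by simp
  show "integrable (ultra_measure lam) (\<lambda>x. (g x)\<^sup>2)"
    using lam by (intro integrable_ultra_measure_continuous continuous_intros g) auto
qed simp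

text \<open>Pythagoras: the competitor differs from the partial sum by D in the span, the residual
  is orthogonal to D, and the integral of D^2 is discarded.\<close>

lemma gegenbauer_partial_best_approx:
  "(\<integral>x. (u x - gegenbauer_partial lam u N x)\<^sup>2 \<partial>ultra_measure lam)
     \<le> (\<integral>x. (u x - (\<Sum>n\<le>N. y n * gegenbauer lam n x))\<^sup>2 \<partial>ultra_measure lam)"
proof -
  let ?M = "ultra_measure lam"
  let ?S = "gegenbauer_partial lam u N"
  let ?P = "\<lambda>x. \<Sum>n\<le>N. y n * gegenbauer lam n x"
  have l: "lam > -1/2" using lam by simp
  define d where "d n = y n - (\<integral>z. u z * gegenbauer lam n z \<partial>?M) / gegenbauer_inner lam n n" for n
  define D where "D x = (\<Sum>n\<le>N. d n * gegenbauer lam n x)" for x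
  have P: "?P x = ?S x + D x" for x
    by (simp add: D_def d_def gegenbauer_partial_def sum.distrib[symmetric] algebra_simps)
  have Dc: "continuous_on UNIV D" unfolding D_def by (intro continuous_intros)
  have I1: "integrable ?M (\<lambda>x. (u x - ?S x) * g x)" if g: "continuous_on UNIV g" for g
    unfolding left_diff_distrib
    by (intro Bochner_Integration.integrable_diff integrable_L2_mult_continuous integrable_ultra_measure_continuous l
        continuous_intros continuous_on_gegenbauer_partial g)
  have "(\<integral>x. (u x - ?S x) * D x \<partial>?M) = (\<integral>x. (\<Sum>n\<le>N. d n * ((u x - ?S x) * gegenbauer lam n x)) \<partial>?M)"
    by (simp add: D_def sum_distrib_left mult_ac)
  also have "\<dots> = (\<Sum>n\<le>N. \<integral>x. d n * ((u x - ?S x) * gegenbauer lam n x) \<partial>?M)"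
    by (intro Bochner_Integration.integral_sum integrable_mult_right I1 continuous_intros)
  also have "\<dots> = 0" by (intro sum.neutral ballI) (simp add: gegenbauer_partial_residual_orthogonal)
  finally have orth: "(\<integral>x. (u x - ?S x) * D x \<partial>?M) = 0" .
  have "(\<integral>x. (u x - ?S x)\<^sup>2 \<partial>?M) = (\<integral>x. (u x - ?S x)\<^sup>2 \<partial>?M) - 2 * (\<integral>x. (u x - ?S x) * D x \<partial>?M)"
    using orth by simp
  also have "\<dots> = (\<integral>x. (u x - ?S x)\<^sup>2 - 2 * ((u x - ?S x) * D x) \<partial>?M)"
    using I1[OF Dc] integrable_residual_square[OF continuous_on_gegenbauer_partial[of lam u N]] by simp
  also have "\<dots> \<le> (\<integral>x. (u x - ?P x)\<^sup>2 \<partial>?M)"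
  proof (rule integral_mono)
    show "integrable ?M (\<lambda>x. (u x - ?S x)\<^sup>2 - 2 * ((u x - ?S x) * D x))"
      using I1[OF Dc] integrable_residual_square[OF continuous_on_gegenbauer_partial[of lam u N]] by simp
    show "integrable ?M (\<lambda>x. (u x - ?P x)\<^sup>2)"
      by (intro integrable_residual_square continuous_intros)
    show "(u x - ?S x)\<^sup>2 - 2 * ((u x - ?S x) * D x) \<le> (u x - ?P x)\<^sup>2" for x
      unfolding P using zero_le_power2[of "D x"] by (simp add: power2_eq_square algebra_simps)
  qed
  finally show ?thesis .
qed

text \<open>A good approximant of degree at most K, padded with zero coefficients, competes for
  every N \<ge> K, so the projection is at least as good from K on.\<close>

lemma gegenbauer_partial_L2_tendsto:
  "(\<lambda>N. \<integral>x. (u x - gegenbauer_partial lam u N x)\<^sup>2 \<partial>ultra_measure lam) \<longlonglongrightarrow> 0"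
proof (rule LIMSEQ_I)
  fix e :: real assume "e > 0"
  then obtain y K where yK: "(\<integral>x. (u x - (\<Sum>m\<le>K. y m * gegenbauer lam m x))\<^sup>2 \<partial>ultra_measure lam) < e"
    using gegenbauer_dense[OF lam u u2] by blast
  have "norm ((\<integral>x. (u x - gegenbauer_partial lam u N x)\<^sup>2 \<partial>ultra_measure lam) - 0) < e" if "N \<ge> K" for N
    using gegenbauer_partial_best_approx[of N "\<lambda>m. if m \<le> K then y m else 0"] yK
    by (simp add: gegenbauer_expansion_extend[OF that, symmetric])
  then show "\<exists>no. \<forall>N\<ge>no. norm ((\<integral>x. (u x - gegenbauer_partial lam u N x)\<^sup>2 \<partial>ultra_measure lam) - 0) < e" by blast
qed

text \<open>The squared residuals tend to 0 in L^1, hence almost everywhere along a subsequence.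
  Fatou's lemma will need this pointwise limit.\<close>

lemma gegenbauer_partial_AE_subseq:
  obtains r :: "nat \<Rightarrow> nat" where "AE x in ultra_measure lam. (\<lambda>j. gegenbauer_partial lam u (r j) x) \<longlonglongrightarrow> u x"
proof -
  have "\<exists>r::nat\<Rightarrow>nat. strict_mono r \<and> (AE x in ultra_measure lam. (\<lambda>j. (u x - gegenbauer_partial lam u (r j) x)\<^sup>2) \<longlonglongrightarrow> 0)"
    using gegenbauer_partial_L2_tendsto
    by (intro tendsto_L1_AE_subseq integrable_residual_square continuous_on_gegenbauer_partial) simp
  then obtain r :: "nat \<Rightarrow> nat" where r: "AE x in ultra_measure lam. (\<lambda>j. (u x - gegenbauer_partial lam u (r j) x)\<^sup>2) \<longlonglongrightarrow> 0"
    by blast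
  have "AE x in ultra_measure lam. (\<lambda>j. gegenbauer_partial lam u (r j) x) \<longlonglongrightarrow> u x"
    using r
  proof eventually_elim
    case (elim x)
    then have "(\<lambda>j. sqrt ((u x - gegenbauer_partial lam u (r j) x)\<^sup>2)) \<longlonglongrightarrow> 0"
      using tendsto_real_sqrt by fastforce
    then have "(\<lambda>j. u x - gegenbauer_partial lam u (r j) x) \<longlonglongrightarrow> 0"
      by (simp add: tendsto_rabs_zero_iff)
    from tendsto_diff[OF tendsto_const[of "u x"] this] show ?case by simp
  qed
  then show ?thesis using that by blast
qed

end

section \<open>The Hardy inequality\<close>

lemma A_mult_pos:
  assumes "lam > 0" "0 < sg" "sg < 1"
  shows "A_mult sg lam n > 0"
  unfolding A_mult_def using assms by (intro divide_pos_pos Gamma_real_pos add_nonneg_pos) auto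

text \<open>The constant is uniform in n because 1/2 \<le> (n + lam) / (2 lam), with equality at n =
  0.\<close>

lemma A_mult_le:
  assumes "lam > 0" "0 < sg" "sg < 1"
  shows "A_mult sg lam n \<le> (1 + 1 / (2 * lam)) powr sg * (real n + lam) powr sg"
proof -
  define z where "z = real n + lam + (1 - sg)/2"
  have z: "z > 0" using assms by (simp add: z_def add_nonneg_pos)
  have "A_mult sg lam n = Gamma (z + sg) / Gamma z"
    unfolding A_mult_def z_def by (simp add: field_simps)
  also have "\<dots> \<le> z powr sg"
    using Gamma_add_le_powr[OF z, of sg] assms Gamma_real_pos[OF z] by (simp add: pos_divide_le_eq mult.commute)
  also have "\<dots> \<le> ((1 + 1 / (2 * lam)) * (real n + lam)) powr sg"
  proof (rule powr_mono2)
    have "z \<le> real n + lam + 1 / 2" using assms by (simp add: z_def)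
    also have "\<dots> \<le> real n + lam + (real n + lam) / (2 * lam)"
      using assms by (intro add_left_mono) (simp add: pos_le_divide_eq)
    also have "\<dots> = (1 + 1 / (2 * lam)) * (real n + lam)" by (simp add: distrib_right)
    finally show "z \<le> (1 + 1 / (2 * lam)) * (real n + lam)" .
  qed (use assms z in auto)
  also have "\<dots> = (1 + 1 / (2 * lam)) powr sg * (real n + lam) powr sg"
    by (rule powr_mult)
  finally show ?thesis .
qed

text \<open>The Sobolev condition makes the series in \<open>A_form\<close> converge, so that its
  \<open>suminf\<close> is a genuine limit and bounds the partial sums.\<close>

lemma A_form_summable:
  assumes "lam > 0" "0 < sg" "sg < 1"
    and "summable (\<lambda>n. (real n + lam) powr sg * (c n)\<^sup>2)"
  shows "summable (\<lambda>n. A_mult sg lam n * (c n)\<^sup>2)"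
proof (rule summable_comparison_test'[OF summable_mult[OF assms(4), of "(1 + 1 / (2 * lam)) powr sg"]])
  fix n :: nat
  show "norm (A_mult sg lam n * (c n)\<^sup>2) \<le> (1 + 1 / (2 * lam)) powr sg * ((real n + lam) powr sg * (c n)\<^sup>2)"
    using mult_right_mono[OF A_mult_le[OF assms(1-3), of n] zero_le_power2[of "c n"]] A_mult_pos[OF assms(1-3), of n]
    by (simp add: abs_mult mult.assoc)
qed

lemma gegenbauer_norm_eq: "gegenbauer_norm lam n = sqrt (gegenbauer_inner lam n n)"
  unfolding gegenbauer_norm_def gegenbauer_inner_def
  by (subst integral_ultra_measure) (auto simp: power2_eq_square)

lemma gegenbauer_coeff_eq:
  assumes [measurable]: "u \<in> borel_measurable borel"
  shows "gegenbauer_coeff lam u n = (\<integral>x. u x * gegenbauer lam n x \<partial>ultra_measure lam) / sqrt (gegenbauer_inner lam n n)"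
proof -
  have "gegenbauer_coeff lam u n = (\<integral>x. u x * gegenbauer lam n x / sqrt (gegenbauer_inner lam n n) \<partial>ultra_measure lam)"
    unfolding gegenbauer_coeff_def gegenbauer_normalized_def gegenbauer_norm_eq
    by (subst integral_ultra_measure) auto
  then show ?thesis by simp
qed

text \<open>The left integral is taken in the extended nonnegative reals, so its finiteness is part
  of the conclusion.\<close>

theorem theorem1:
  fixes lam sg :: real and u :: "real \<Rightarrow> real"
  assumes "lam > 0" and "0 < sg" and "sg < 1"
    and "in_Sobolev_lam sg lam u"
  shows "ennreal (2 powr sg * (Gamma (lam/2 + (1 + sg)/4))\<^sup>2 / (Gamma (lam/2 + (1 - sg)/4))\<^sup>2)
           * (\<integral>\<^sup>+ x. ennreal (indicator {-1<..<1} x * (u x)\<^sup>2 / (1 - x\<^sup>2) powr (sg/2)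
                 * ultra_weight lam x) \<partial>lborel)
         \<le> ennreal (A_form sg lam u)"
proof -
  let ?M = "ultra_measure lam"
  define Q where "Q = hardy_const sg lam"
  define A where "A = A_form sg lam u"
  have Q: "Q > 0" unfolding Q_def by (rule hardy_const_pos[OF assms(1-3)])
  have [measurable]: "u \<in> borel_measurable borel" and u2: "integrable ?M (\<lambda>x. (u x)\<^sup>2)"
    and sm: "summable (\<lambda>n. (real n + lam) powr sg * (gegenbauer_coeff lam u n)\<^sup>2)"
    using assms(4) by (auto simp: in_Sobolev_lam_def in_L2_lam_def integrable_ultra_measure_iff)
  have u: "u \<in> borel_measurable borel" by fact
  have h: "gegenbauer_inner lam n n > 0" for n by (rule gegenbauer_inner_self_pos[OF assms(1)])
  obtain r where r: "AE x in ?M. (\<lambda>j. gegenbauer_partial lam u (r j) x) \<longlonglongrightarrow> u x"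
    using gegenbauer_partial_AE_subseq[OF assms(1) u u2] by blast
  have [measurable]: "gegenbauer_partial lam u N \<in> borel_measurable borel" for N
    by (intro borel_measurable_continuous_onI continuous_on_gegenbauer_partial)
  \<comment> \<open>Uniform in N, so passing to the subsequence \<open>r\<close> costs
    nothing.\<close>
  have bound: "(\<integral>\<^sup>+x. ennreal ((gegenbauer_partial lam u N x)\<^sup>2 * (1 - x\<^sup>2) powr (- (sg/2))) \<partial>?M) \<le> ennreal (A / Q)" for N
  proof -
    let ?S = "gegenbauer_partial lam u N"
    have l: "lam - sg/2 > -1/2" using assms by simp
    have S2: "continuous_on UNIV (\<lambda>x. (?S x)\<^sup>2)"
      by (intro continuous_intros continuous_on_gegenbauer_partial)
    have int: "integrable ?M (\<lambda>x. (?S x)\<^sup>2 * (1 - x\<^sup>2) powr (- (sg/2)))"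
      using integrable_ultra_measure_shift[of "\<lambda>x. (?S x)\<^sup>2" lam "- (sg/2)"]
        integrable_ultra_measure_continuous[OF l S2] by simp
    have "(\<integral>x. (?S x)\<^sup>2 * (1 - x\<^sup>2) powr (- (sg/2)) \<partial>?M) = (\<integral>x. (?S x)\<^sup>2 \<partial>ultra_measure (lam - sg/2))"
      using integral_ultra_measure_shift[of "\<lambda>x. (?S x)\<^sup>2" lam "- (sg/2)"] by simp
    moreover have "Q * (\<integral>x. (?S x)\<^sup>2 \<partial>ultra_measure (lam - sg/2))
       \<le> (\<Sum>n\<le>N. A_mult sg lam n * gegenbauer_inner lam n n *
             ((\<integral>z. u z * gegenbauer lam n z \<partial>?M) / gegenbauer_inner lam n n)\<^sup>2)"
      unfolding Q_def gegenbauer_partial_def by (rule hardy_polynomial[OF assms(1-3)])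
    \<comment> \<open>With h the squared norm and I the integral of u C_n, h (I / h)^2 = (I / sqrt
      h)^2 passes to the normalised coefficients.\<close>
    moreover have "\<dots> = (\<Sum>n\<le>N. A_mult sg lam n * (gegenbauer_coeff lam u n)\<^sup>2)"
      unfolding gegenbauer_coeff_eq[OF u] using h less_imp_neq[OF h]
      by (intro sum.cong refl) (simp add: power_divide less_imp_le power2_eq_square)
    moreover have "\<dots> \<le> A"
      unfolding A_def A_form_def using A_mult_pos[OF assms(1-3)]
      by (intro sum_le_suminf A_form_summable[OF assms(1-3) sm]) (auto simp: less_imp_le)
    ultimately have "(\<integral>x. (?S x)\<^sup>2 * (1 - x\<^sup>2) powr (- (sg/2)) \<partial>?M) \<le> A / Q"
      using Q by (simp add: pos_le_divide_eq mult.commute)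
    then show ?thesis by (subst nn_integral_eq_integral[OF int]) (auto intro: ennreal_leI)
  qed
  have "(\<integral>\<^sup>+ x. ennreal (indicator {-1<..<1} x * (u x)\<^sup>2 / (1 - x\<^sup>2) powr (sg/2) * ultra_weight lam x) \<partial>lborel)
      = (\<integral>\<^sup>+x. ennreal ((u x)\<^sup>2 * (1 - x\<^sup>2) powr (- (sg/2))) \<partial>?M)"
  proof -
    have "(\<integral>\<^sup>+x. ennreal ((u x)\<^sup>2 * (1 - x\<^sup>2) powr (- (sg/2))) \<partial>?M)
        = (\<integral>\<^sup>+x. ennreal (indicator {-1<..<1} x * ultra_weight lam x) * ennreal ((u x)\<^sup>2 * (1 - x\<^sup>2) powr (- (sg/2))) \<partial>lborel)"
      unfolding ultra_measure_def by (subst nn_integral_density) auto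
    also have "\<dots> = (\<integral>\<^sup>+ x. ennreal (indicator {-1<..<1} x * (u x)\<^sup>2 / (1 - x\<^sup>2) powr (sg/2) * ultra_weight lam x) \<partial>lborel)"
    proof (rule nn_integral_cong)
      fix x
      have "ennreal (indicator {-1<..<1} x * ultra_weight lam x) * ennreal ((u x)\<^sup>2 * (1 - x\<^sup>2) powr (- (sg/2)))
          = ennreal ((indicator {-1<..<1} x * ultra_weight lam x) * ((u x)\<^sup>2 * (1 - x\<^sup>2) powr (- (sg/2))))"
        by (rule ennreal_mult'[symmetric]) simp
      then show "ennreal (indicator {-1<..<1} x * ultra_weight lam x) * ennreal ((u x)\<^sup>2 * (1 - x\<^sup>2) powr (- (sg/2)))
          = ennreal (indicator {-1<..<1} x * (u x)\<^sup>2 / (1 - x\<^sup>2) powr (sg/2) * ultra_weight lam x)"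
        by (simp only: powr_minus divide_inverse mult_ac)
    qed
    finally show ?thesis by simp
  qed
  \<comment> \<open>Almost everywhere the limit along \<open>r\<close> exists and equals the
    integrand, so it may be written as a liminf, the form that Fatou's lemma takes.\<close>
  also have "\<dots> = (\<integral>\<^sup>+x. liminf (\<lambda>j. ennreal ((gegenbauer_partial lam u (r j) x)\<^sup>2 * (1 - x\<^sup>2) powr (- (sg/2)))) \<partial>?M)"
  proof (rule nn_integral_cong_AE, use r in eventually_elim)
    case (elim x)
    then have "(\<lambda>j. ennreal ((gegenbauer_partial lam u (r j) x)\<^sup>2 * (1 - x\<^sup>2) powr (- (sg/2))))
        \<longlonglongrightarrow> ennreal ((u x)\<^sup>2 * (1 - x\<^sup>2) powr (- (sg/2)))"
      by (intro tendsto_ennrealI tendsto_mult tendsto_power tendsto_const)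
    then show ?case by (rule lim_imp_Liminf[OF sequentially_bot, symmetric])
  qed
  also have "\<dots> \<le> liminf (\<lambda>j. \<integral>\<^sup>+x. ennreal ((gegenbauer_partial lam u (r j) x)\<^sup>2 * (1 - x\<^sup>2) powr (- (sg/2))) \<partial>?M)"
    by (intro nn_integral_liminf) measurable
  also have "\<dots> \<le> ennreal (A / Q)"
    by (intro Liminf_le) (auto intro: always_eventually bound)
  finally have "ennreal Q * (\<integral>\<^sup>+ x. ennreal (indicator {-1<..<1} x * (u x)\<^sup>2 / (1 - x\<^sup>2) powr (sg/2) * ultra_weight lam x) \<partial>lborel)
      \<le> ennreal Q * ennreal (A / Q)"
    by (rule mult_left_mono) simp
  also have "\<dots> = ennreal A" using Q by (simp add: ennreal_mult'[symmetric] less_imp_le)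
  finally show ?thesis by (simp add: Q_def A_def hardy_const_def)
qed

end
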